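(* Let $\Lambda$ be a fixed finite alphabet, let $\mathcal{P}$ be any symmetric $\Lambda$-valued communication problem, let $r\in\mathbb{N}$, and let $g\colon\Lambda^{\le r}\to\Lambda$ be permutation-invariant. Then for every $n$, all $P_1,\dots,P_n\in\mathcal{P}$, and every error parameter $\delta$, \[ \mathsf{R}_\delta\big(g[P_1\bullet P_2\bullet\cdots\bullet P_n]\big)=O\!\left(r\log\tfrac{r}{\delta}+r\Big(\max_i \mathsf{R}_{\delta/10r}(P_i)+\log\tfrac{1}{\delta}\Big)\right). \] In particular, if $\mathcal{P}$ has a constant-cost protocol, then $\mathsf{R}_\delta(g[\mathcal{P}])=O\!\left(r\log\tfrac{r}{\delta}\right)$.
   Context: A $\Lambda$-valued communication problem is a set of $\Lambda$-valued matrices; it is symmetric if every matrix $P$ in it is symmetric, i.e. $P(x,y)=P(y,x)$. $\mathsf{R}_\delta(P)$ is the public-coin randomized two-way communication cost of computing $P$ with error probability at most $\delta$, and for a set of matrices it is the supremum over its members. A problem has a constant-cost protocol if there is a constant $c$ with $\mathsf{R}_{1/4}(P)\le c$ for all its members. A function $g\colon\Lambda^{\le r}\to\Lambda$ (defined on strings over $\Lambda$ of length at most $r$) is permutation-invariant if $g(u)=g(v)$ whenever $v$ is a permutation of $u$. Distance-$r$ composition: given matrices $P_1,\dots,P_n\in\mathcal{P}$, Alice gets $x=(x_1,\dots,x_n)$ and Bob gets $y=(y_1,\dots,y_n)$ where $x_i$ is a row index and $y_i$ a column index of $P_i$. Let $(P_1\bullet\cdots\bullet P_n)(x,y)$ denote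 the sequence $(P_i(x_i,y_i) : i\in[n],\,x_i\neq y_i)$. Then $g[P_1\bullet\cdots\bullet P_n](x,y)=\bot$ if $|\{i: x_i\neq y_i\}|>r$, and otherwise equals $g\big((P_1\bullet\cdots\bullet P_n)(x,y)\big)$. The class $g[\mathcal{P}]$ consists of all such problems $g[P_1\bullet\cdots\bullet P_n]$ over all $n$ and all $P_1,\dots,P_n\in\mathcal{P}$. *)

theory Defs
  imports "HOL-Probability.Probability_Mass_Function" "HOL-Library.Extended_Real"
    "HOL-Library.Multiset"
begin

record ('a, 'b, 'v) comm_matrix =
  row_set :: "'a set"
  col_set :: "'b set"
  entry :: "'a \<Rightarrow> 'b \<Rightarrow> 'v"

text \<open>Entries outside \<open>row_set \<times> col_set\<close> are junk and never consulted.\<close>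

definition finite_matrix :: "('a, 'b, 'v) comm_matrix \<Rightarrow> bool" where
  "finite_matrix P \<longleftrightarrow> finite (row_set P) \<and> finite (col_set P)"

definition symmetric_matrix :: "('a, 'a, 'v) comm_matrix \<Rightarrow> bool" where
  "symmetric_matrix P \<longleftrightarrow> row_set P = col_set P \<and>
     (\<forall>x\<in>row_set P. \<forall>y\<in>col_set P. entry P x y = entry P y x)"

definition symmetric_problem :: "('a, 'a, 'v) comm_matrix set \<Rightarrow> bool" where
  "symmetric_problem \<P> \<longleftrightarrow> (\<forall>P\<in>\<P>. finite_matrix P \<and> symmetric_matrix P)"

text \<open>Deterministic two-way protocol trees. At an inner node the named player sends one bit
  computed from that player's input; on \<open>True\<close> the protocol moves to the first subtree.
  The output is a function of the transcript, so both players know it.\<close>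

datatype ('a, 'b, 'v) protocol =
    Output 'v
  | Alice "'a \<Rightarrow> bool" "('a, 'b, 'v) protocol" "('a, 'b, 'v) protocol"
  | Bob "'b \<Rightarrow> bool" "('a, 'b, 'v) protocol" "('a, 'b, 'v) protocol"

primrec run :: "('a, 'b, 'v) protocol \<Rightarrow> 'a \<Rightarrow> 'b \<Rightarrow> 'v" where
  "run (Output v) x y = v"
| "run (Alice f S T) x y = (if f x then run S x y else run T x y)"
| "run (Bob f S T) x y = (if f y then run S x y else run T x y)"

primrec cost :: "('a, 'b, 'v) protocol \<Rightarrow> nat" where
  "cost (Output v) = 0"
| "cost (Alice f S T) = Suc (max (cost S) (cost T))"
| "cost (Bob f S T) = Suc (max (cost S) (cost T))"

text \<open>A public-coin protocol is a probability distribution over deterministic protocols. The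
  error is bounded on every input, and the cost is the worst case over inputs and coins.\<close>

definition computes_with_error ::
  "('a, 'b, 'v) protocol pmf \<Rightarrow> ('a, 'b, 'v) comm_matrix \<Rightarrow> real \<Rightarrow> bool" where
  "computes_with_error D P \<delta> \<longleftrightarrow>
     (\<forall>x\<in>row_set P. \<forall>y\<in>col_set P.
        measure_pmf.prob D {T. run T x y \<noteq> entry P x y} \<le> \<delta>)"

text \<open>The infimum is taken in \<^typ>\<open>enat\<close>, so it is \<open>\<infinity>\<close> if no protocol exists.\<close>

definition rand_cost :: "real \<Rightarrow> ('a, 'b, 'v) comm_matrix \<Rightarrow> enat" where
  "rand_cost \<delta> P =
     (INF c\<in>{c. \<exists>D. computes_with_error D P \<delta> \<and> (\<forall>T\<in>set_pmf D. cost T \<le> c)}. enat c)"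

definition rand_cost_problem :: "real \<Rightarrow> ('a, 'b, 'v) comm_matrix set \<Rightarrow> enat" where
  "rand_cost_problem \<delta> \<P> = (SUP P\<in>\<P>. rand_cost \<delta> P)"

definition constant_cost :: "('a, 'b, 'v) comm_matrix set \<Rightarrow> bool" where
  "constant_cost \<P> \<longleftrightarrow> (\<exists>c::nat. \<forall>P\<in>\<P>. rand_cost (1/4) P \<le> enat c)"

text \<open>A function on strings of length at most \<open>r\<close> is represented by a function on all lists
  whose values on longer lists are irrelevant.\<close>

definition perm_invariant :: "nat \<Rightarrow> ('v list \<Rightarrow> 'v) \<Rightarrow> bool" where
  "perm_invariant r g \<longleftrightarrow>
     (\<forall>u v. length u \<le> r \<longrightarrow> mset v = mset u \<longrightarrow> g u = g v)"

text \<open>The index set of the composition is the product of the index sets.\<close>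

definition tuples :: "'a set list \<Rightarrow> 'a list set" where
  "tuples As = {x. length x = length As \<and> (\<forall>i<length As. x ! i \<in> As ! i)}"

definition diff_seq :: "('a, 'a, 'v) comm_matrix list \<Rightarrow> 'a list \<Rightarrow> 'a list \<Rightarrow> 'v list" where
  "diff_seq Ps x y = [entry (Ps ! i) (x ! i) (y ! i). i \<leftarrow> [0..<length Ps], x ! i \<noteq> y ! i]"

text \<open>\<open>None\<close> plays the role of \<open>\<bottom>\<close>.\<close>

definition dist_comp ::
  "nat \<Rightarrow> ('v list \<Rightarrow> 'v) \<Rightarrow> ('a, 'a, 'v) comm_matrix list \<Rightarrow>
     ('a list, 'a list, 'v option) comm_matrix" where
  "dist_comp r g Ps =
     \<lparr> row_set = tuples (map row_set Ps),
       col_set = tuples (map col_set Ps),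
       entry = (\<lambda>x y. if card {i. i < length Ps \<and> x ! i \<noteq> y ! i} > r then None
                      else Some (g (diff_seq Ps x y))) \<rparr>"

definition dist_comp_problem ::
  "nat \<Rightarrow> ('v list \<Rightarrow> 'v) \<Rightarrow> ('a, 'a, 'v) comm_matrix set \<Rightarrow>
     ('a list, 'a list, 'v option) comm_matrix set" where
  "dist_comp_problem r g \<P> = {dist_comp r g Ps | Ps. set Ps \<subseteq> \<P>}"

end

theory Submission imports Defs "HOL-Probability.Product_PMF" begin

text \<open>With public randomness, distribute the coordinates into about \<open>r\<^sup>2 / \<delta>\<close> buckets and hash the
  entries of the coordinates into a range of the same size. A player's sketch counts, for each bucket
  and hash value, the coordinates of the bucket whose entry has this hash value. If there are at most
  \<open>r\<close> differing coordinates, then most likely they lie in distinct buckets and each changes one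
  sketch entry by \<open>+1\<close> and one by \<open>-1\<close>; otherwise more than \<open>r\<close> buckets change. Only
  \<open>(r / \<delta>)\<^bsup>O(r)\<^esup>\<close> sparse changes are possible, so a random fingerprint of \<open>O(r log (r / \<delta>))\<close> bits
  of Alice's sketch lets Bob find the change, which he sends back, or detect that there is none.

  In each changed bucket the players do not know the differing coordinate \<open>i\<close>, so they simulate the
  protocols of all coordinates of the bucket in parallel. The two changed hash values tell which role
  to play in a coordinate, and the parity of all messages of both players is the true message of
  coordinate \<open>i\<close>, since equal coordinates contribute twice. The same idea reveals the output at \<open>i\<close>;
  permutation invariance of \<open>g\<close> makes the order of the outputs irrelevant.\<close>

section \<open>Composing deterministic protocols\<close>

text \<open>Relations allow protocols to be assembled backwards: what has been communicated so far
  becomes a premise of the relation, and the remaining tree has to be right only on inputs that meet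
  it.\<close>

definition solvable :: "nat \<Rightarrow> ('a \<Rightarrow> 'b \<Rightarrow> 'v \<Rightarrow> bool) \<Rightarrow> bool" where
  "solvable c R \<longleftrightarrow> (\<exists>T. cost T \<le> c \<and> (\<forall>x y. R x y (run T x y)))"

lemma solvable_mono:
  assumes "solvable c R" "c \<le> c'" "\<And>x y v. R x y v \<Longrightarrow> R' x y v"
  shows "solvable c' R'"
  using assms unfolding solvable_def by (meson order_trans)

lemma solvable_Output: "(\<And>x y. R x y v) \<Longrightarrow> solvable c R"
  unfolding solvable_def by (intro exI[of _ "Output v"]) auto

lemma solvable_Alice:
  assumes "solvable c (\<lambda>x y v. f x \<longrightarrow> R x y v)" "solvable c (\<lambda>x y v. \<not> f x \<longrightarrow> R x y v)"
  shows "solvable (Suc c) R"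
proof -
  obtain S T where "cost S \<le> c" "\<forall>x y. f x \<longrightarrow> R x y (run S x y)"
    "cost T \<le> c" "\<forall>x y. \<not> f x \<longrightarrow> R x y (run T x y)"
    using assms unfolding solvable_def by blast
  then show ?thesis unfolding solvable_def by (intro exI[of _ "Alice f S T"]) auto
qed

primrec swap_players :: "('a, 'b, 'v) protocol \<Rightarrow> ('b, 'a, 'v) protocol" where
  "swap_players (Output v) = Output v"
| "swap_players (Alice f S T) = Bob f (swap_players S) (swap_players T)"
| "swap_players (Bob f S T) = Alice f (swap_players S) (swap_players T)"

lemma run_swap_players: "run (swap_players T) y x = run T x y"
  by (induction T) auto

lemma cost_swap_players: "cost (swap_players T) = cost T"
  by (induction T) auto

lemma solvable_swap: "solvable c (\<lambda>x y. R y x) \<Longrightarrow> solvable c R"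
  unfolding solvable_def by (metis run_swap_players cost_swap_players)

lemma solvable_Bob:
  assumes "solvable c (\<lambda>x y v. f y \<longrightarrow> R x y v)" "solvable c (\<lambda>x y v. \<not> f y \<longrightarrow> R x y v)"
  shows "solvable (Suc c) R"
  by (rule solvable_swap, rule solvable_Alice[of _ f]) (rule solvable_swap, fact assms)+

lemma split_set_pow2:
  assumes "finite S" "card S \<le> 2 ^ Suc m"
  obtains S1 where "S1 \<subseteq> S" "card S1 \<le> 2 ^ m" "card (S - S1) \<le> 2 ^ m"
proof -
  have "min (2 ^ m) (card S) \<le> card S" by simp
  then obtain S1 where S1: "S1 \<subseteq> S" "card S1 = min (2 ^ m) (card S)"
    by (rule obtain_subset_with_card_n)
  then have "card (S - S1) = card S - card S1"
    using assms(1) by (simp add: card_Diff_subset finite_subset)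
  with S1 assms show thesis by (intro that[of S1]) auto
qed

text \<open>Each bit tells in which half of \<open>S\<close> the value \<open>f x\<close> lies, so
  \<open>m\<close> bits single it out; the continuation may then treat it as the constant
  \<open>s\<close>.\<close>

lemma solvable_Alice_tells:
  assumes "finite S" "card S \<le> 2 ^ m"
    and "\<And>s. s \<in> S \<Longrightarrow> solvable c (\<lambda>x y v. f x = s \<longrightarrow> R x y v)"
  shows "solvable (m + c) (\<lambda>x y v. f x \<in> S \<longrightarrow> R x y v)"
  using assms
proof (induction m arbitrary: S)
  case 0
  show ?case
  proof (cases "S = {}")
    case False
    then obtain s where "S = {s}" using 0 by (metis One_nat_def card_0_eq card_1_singletonE
        le_SucE le_zero_eq power_0)
    then show ?thesis using 0 by simp
  qed (auto intro: solvable_Output)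
next
  case (Suc m)
  obtain S1 where S1: "S1 \<subseteq> S" "card S1 \<le> 2 ^ m" "card (S - S1) \<le> 2 ^ m"
    using split_set_pow2 Suc.prems by blast
  have "finite S1" using S1(1) Suc.prems(1) finite_subset by blast
  then have 1: "solvable (m + c) (\<lambda>x y v. f x \<in> S1 \<longrightarrow> R x y v)"
    and 2: "solvable (m + c) (\<lambda>x y v. f x \<in> S - S1 \<longrightarrow> R x y v)"
    using S1 Suc.prems by (blast intro!: Suc.IH)+
  have "solvable (Suc (m + c)) (\<lambda>x y v. f x \<in> S \<longrightarrow> R x y v)"
    by (rule solvable_Alice[where f = "\<lambda>x. f x \<in> S1"], rule solvable_mono[OF 1], simp, blast,
        rule solvable_mono[OF 2]) auto
  then show ?case by simp
qed

lemma solvable_Bob_tells: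
  assumes "finite S" "card S \<le> 2 ^ m"
    and "\<And>s. s \<in> S \<Longrightarrow> solvable c (\<lambda>x y v. f y = s \<longrightarrow> R x y v)"
  shows "solvable (m + c) (\<lambda>x y v. f y \<in> S \<longrightarrow> R x y v)"
  by (rule solvable_swap, rule solvable_Alice_tells[OF assms(1,2)], rule solvable_swap)
    (rule assms(3))

lemma solvable_run:
  assumes "cost T \<le> m" "\<And>v. solvable c (\<lambda>x y w. run T x y = v \<longrightarrow> R x y w)"
  shows "solvable (m + c) R"
  using assms
proof (induction T arbitrary: m R)
  case (Output v)
  have "solvable c (\<lambda>x y w. run (Output v) x y = v \<longrightarrow> R x y w)" by (rule Output)
  then show ?case by (rule solvable_mono) auto
next
  case (Alice f S T)
  then obtain m' where m: "m = Suc m'" by (cases m) auto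
  have "solvable (m' + c) (\<lambda>x y v. f x \<longrightarrow> R x y v)"
    by (rule Alice.IH(1)) (use Alice.prems m in \<open>auto intro: solvable_mono[OF Alice.prems(2)]\<close>)
  moreover have "solvable (m' + c) (\<lambda>x y v. \<not> f x \<longrightarrow> R x y v)"
    by (rule Alice.IH(2)) (use Alice.prems m in \<open>auto intro: solvable_mono[OF Alice.prems(2)]\<close>)
  ultimately show ?case using m by (simp add: solvable_Alice)
next
  case (Bob f S T)
  then obtain m' where m: "m = Suc m'" by (cases m) auto
  have "solvable (m' + c) (\<lambda>x y v. f y \<longrightarrow> R x y v)"
    by (rule Bob.IH(1)) (use Bob.prems m in \<open>auto intro: solvable_mono[OF Bob.prems(2)]\<close>)
  moreover have "solvable (m' + c) (\<lambda>x y v. \<not> f y \<longrightarrow> R x y v)"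
    by (rule Bob.IH(2)) (use Bob.prems m in \<open>auto intro: solvable_mono[OF Bob.prems(2)]\<close>)
  ultimately show ?case using m by (simp add: solvable_Bob)
qed

section \<open>Parallel simulation of a block of protocols\<close>

text \<open>Modulo 2 the indices other than \<open>i\<close> contribute the same to both
  cardinalities and cancel.\<close>

lemma parity_differs_iff:
  assumes "finite J" "i \<in> J" "\<And>j. j \<in> J \<Longrightarrow> j \<noteq> i \<Longrightarrow> P j = Q j"
  shows "odd (card {j \<in> J. P j}) \<noteq> odd (card {j \<in> J. Q j}) \<longleftrightarrow> P i \<noteq> Q i"
proof -
  have *: "card {j \<in> J. P j} = card {j \<in> J - {i}. P j} + of_bool (P i)" for P
  proof -
    have "{j \<in> J. P j} = (if P i then insert i {j \<in> J - {i}. P j} else {j \<in> J - {i}. P j})"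
      using assms(2) by auto
    then show ?thesis using assms(1) by auto
  qed
  have "{j \<in> J - {i}. P j} = {j \<in> J - {i}. Q j}" using assms(3) by auto
  then show ?thesis unfolding *[of P] *[of Q] by auto
qed

text \<open>A block of protocols is simulated in parallel with the inputs of all coordinates in \<open>J\<close>. At
  coordinate \<open>j\<close> a player plays Alice's role if \<open>A j\<close> holds of their own entry and Bob's role if
  \<open>B j\<close> does; since the entries agree outside a single coordinate \<open>i\<close>, the exclusive or of the
  parities of both players' contributions is the contribution of coordinate \<open>i\<close> alone.\<close>

primrec message :: "('a \<Rightarrow> bool) \<Rightarrow> ('a \<Rightarrow> bool) \<Rightarrow> ('a, 'a, 'v) protocol \<Rightarrow> 'a \<Rightarrow> bool" where
  "message A B (Output v) z = False"
| "message A B (Alice f S T) z = (A z \<and> f z)"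
| "message A B (Bob f S T) z = (B z \<and> f z)"

text \<open>The first argument is the transmitted bit. A leaf stays put, which lets protocols of
  different lengths run in lockstep.\<close>

primrec advance :: "bool \<Rightarrow> ('a, 'b, 'v) protocol \<Rightarrow> ('a, 'b, 'v) protocol" where
  "advance t (Output v) = Output v"
| "advance t (Alice f S T) = (if t then S else T)"
| "advance t (Bob f S T) = (if t then S else T)"

lemma cost_advance: "cost T \<le> Suc m \<Longrightarrow> cost (advance t T) \<le> m"
  by (cases T) auto

text \<open>The last four conditions keep the roles apart: at the only differing coordinate of the
  block, the owner of \<open>x\<close> speaks for Alice alone and the owner of \<open>y\<close> for
  Bob alone.\<close>

definition isolates ::
  "nat set \<Rightarrow> (nat \<Rightarrow> 'a \<Rightarrow> bool) \<Rightarrow> (nat \<Rightarrow> 'a \<Rightarrow> bool) \<Rightarrow> nat \<Rightarrow> 'a list \<Rightarrow> 'a list \<Rightarrow> bool" where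
  "isolates J A B i x y \<longleftrightarrow> i \<in> J \<and> (\<forall>j\<in>J. j \<noteq> i \<longrightarrow> x ! j = y ! j) \<and>
     A i (x ! i) \<and> \<not> B i (x ! i) \<and> B i (y ! i) \<and> \<not> A i (y ! i)"

text \<open>By cancellation \<open>a \<noteq> b\<close> is the exclusive or of the two messages at
  \<open>i\<close>. The player who does not have the turn contributes \<open>False\<close>, so the
  other message survives, which is the bit of the protocol.\<close>

lemma run_advance:
  assumes "finite J" "isolates J A B i x y"
    and "a = odd (card {j \<in> J. message (A j) (B j) (N j) (x ! j)})"
    and "b = odd (card {j \<in> J. message (A j) (B j) (N j) (y ! j)})"
  shows "run (advance (a \<noteq> b) (N i)) (x ! i) (y ! i) = run (N i) (x ! i) (y ! i)"
proof -
  have "(a \<noteq> b) = (message (A i) (B i) (N i) (x ! i) \<noteq> message (A i) (B i) (N i) (y ! i))"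
    unfolding assms(3,4)
    by (rule parity_differs_iff) (use assms(1,2) in \<open>auto simp: isolates_def\<close>)
  then show ?thesis using assms(2) by (cases "N i") (auto simp: isolates_def)
qed

lemma solvable_bool_Alice:
  assumes "\<And>s. solvable c (\<lambda>x y v. f x = (s::bool) \<longrightarrow> R x y v)"
  shows "solvable (Suc c) R"
  using assms[of True] assms[of False] by (intro solvable_Alice[of c f]) auto

lemma solvable_bool_Bob:
  assumes "\<And>s. solvable c (\<lambda>x y v. f y = (s::bool) \<longrightarrow> R x y v)"
  shows "solvable (Suc c) R"
  using assms[of True] assms[of False] by (intro solvable_Bob[of c f]) auto

text \<open>Every round advances all protocols of the block by one node, for one parity bit of each
  player. The final \<open>2 * CARD('l)\<close> bits reveal the leaf reached at the isolated
  coordinate without naming the coordinate.\<close>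

lemma solvable_simulate:
  fixes N :: "nat \<Rightarrow> ('a, 'a, 'l::finite) protocol"
  assumes "finite J" "\<And>j. j \<in> J \<Longrightarrow> cost (N j) \<le> m"
    and "\<And>v. solvable c (\<lambda>x y w.
           (\<forall>i. isolates J A B i x y \<longrightarrow> run (N i) (x ! i) (y ! i) = v) \<longrightarrow> R x y w)"
  shows "solvable (2 * m + 2 * CARD('l) + c) R"
  using assms(2,3)
proof (induction m arbitrary: N R)
  case 0
  \<comment> \<open>Only the role \<open>A\<close> is counted, so the isolated coordinate changes
    the parity of exactly its own output letter. The symmetric difference of the two players' sets
    is that singleton.\<close>
  define out where "out x = {v. odd (card {j \<in> J. A j (x ! j) \<and> N j = Output v})}" for x
  have leaf: "\<exists>v. N j = Output v" if "j \<in> J" for j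
    using 0(1)[OF that] by (cases "N j") auto
  have sep: "run (N i) (x ! i) (y ! i) = the_elem ((out x - out y) \<union> (out y - out x))"
    if iso: "isolates J A B i x y" for i x y
  proof -
    have "i \<in> J" using iso by (simp add: isolates_def)
    then obtain v where v: "N i = Output v" using leaf by blast
    have "(u \<in> out x) \<noteq> (u \<in> out y) \<longleftrightarrow> u = v" for u
    proof -
      have "(u \<in> out x) \<noteq> (u \<in> out y) \<longleftrightarrow>
        (A i (x ! i) \<and> N i = Output u) \<noteq> (A i (y ! i) \<and> N i = Output u)"
        unfolding out_def mem_Collect_eq
        by (rule parity_differs_iff) (use iso assms(1) in \<open>auto simp: isolates_def\<close>)
      then show ?thesis using iso v by (auto simp: isolates_def)
    qed
    then have "(out x - out y) \<union> (out y - out x) = {v}" by blast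
    then show ?thesis using v by simp
  qed
  have inner: "solvable c (\<lambda>x y v. out y = s' \<longrightarrow> out x = s \<longrightarrow> R x y v)" for s s'
    by (rule solvable_mono[OF 0(2)[of "the_elem ((s - s') \<union> (s' - s))"]]) (auto dest: sep)
  have "solvable (CARD('l) + c) (\<lambda>x y v. out x = s \<longrightarrow> R x y v)" for s
    using solvable_Bob_tells[of "UNIV :: 'l set set" "CARD('l)" c out "\<lambda>x y v. out x = s \<longrightarrow> R x y v"] inner
    by (simp add: card_UNIV_set)
  then have "solvable (CARD('l) + (CARD('l) + c)) R"
    using solvable_Alice_tells[of "UNIV :: 'l set set" "CARD('l)" "CARD('l) + c" out R]
    by (simp add: card_UNIV_set)
  then show ?case by (simp add: mult_2 add.assoc)
next
  case (Suc m)
  define msg where "msg x = odd (card {j \<in> J. message (A j) (B j) (N j) (x ! j)})" for x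
  have "solvable (2 * m + 2 * CARD('l) + c) (\<lambda>x y v. msg y = b \<longrightarrow> msg x = a \<longrightarrow> R x y v)" for a b
  proof (rule Suc.IH[where N = "\<lambda>j. advance (a \<noteq> b) (N j)"])
    fix v
    show "solvable c (\<lambda>x y w. (\<forall>i. isolates J A B i x y \<longrightarrow>
        run (advance (a \<noteq> b) (N i)) (x ! i) (y ! i) = v) \<longrightarrow> msg y = b \<longrightarrow> msg x = a \<longrightarrow> R x y w)"
    proof (rule solvable_mono[OF Suc.prems(2)[of v]])
      fix x y w
      assume R: "(\<forall>i. isolates J A B i x y \<longrightarrow> run (N i) (x ! i) (y ! i) = v) \<longrightarrow> R x y w"
      have "run (advance (a \<noteq> b) (N i)) (x ! i) (y ! i) = run (N i) (x ! i) (y ! i)"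
        if "isolates J A B i x y" "msg y = b" "msg x = a" for i
        by (rule run_advance[OF assms(1) that(1)]) (use that(2,3) msg_def in auto)
      with R show "(\<forall>i. isolates J A B i x y \<longrightarrow>
        run (advance (a \<noteq> b) (N i)) (x ! i) (y ! i) = v) \<longrightarrow> msg y = b \<longrightarrow> msg x = a \<longrightarrow> R x y w"
        by metis
    qed simp
  qed (use Suc.prems(1) cost_advance in blast)
  then have "solvable (Suc (2 * m + 2 * CARD('l) + c)) (\<lambda>x y v. msg x = a \<longrightarrow> R x y v)" for a
    by (rule solvable_bool_Bob)
  then have "solvable (Suc (Suc (2 * m + 2 * CARD('l) + c))) R"
    by (rule solvable_bool_Alice)
  then show ?case by simp
qed

text \<open>The blocks are simulated one after another, and \<open>f\<close> collects the outputs.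
  Distinct keys ensure that recording the output of \<open>k\<close> leaves those of the other
  blocks alone.\<close>

lemma solvable_simulate_list:
  fixes N :: "nat \<Rightarrow> ('a, 'a, 'l::finite) protocol"
  assumes "distinct ks" "\<And>k. k \<in> set ks \<Longrightarrow> finite (J k)"
    and "\<And>k j. k \<in> set ks \<Longrightarrow> j \<in> J k \<Longrightarrow> cost (N j) \<le> m"
    and "\<And>f. solvable c (\<lambda>x y w. (\<forall>k\<in>set ks. \<forall>i. isolates (J k) (A k) (B k) i x y \<longrightarrow>
           run (N i) (x ! i) (y ! i) = f k) \<longrightarrow> R x y w)"
  shows "solvable (length ks * (2 * m + 2 * CARD('l)) + c) R"
  using assms
proof (induction ks arbitrary: R)
  case Nil
  then show ?case by simp
next
  case (Cons k ks)
  have "solvable (2 * m + 2 * CARD('l) + (length ks * (2 * m + 2 * CARD('l)) + c)) R"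
  proof (rule solvable_simulate[of "J k" N _ _ "A k" "B k"])
    fix v
    show "solvable (length ks * (2 * m + 2 * CARD('l)) + c) (\<lambda>x y w. (\<forall>i. isolates (J k) (A k) (B k) i x y \<longrightarrow>
      run (N i) (x ! i) (y ! i) = v) \<longrightarrow> R x y w)"
    proof (rule Cons.IH)
      fix f
      show "solvable c (\<lambda>x y w. (\<forall>k\<in>set ks. \<forall>i. isolates (J k) (A k) (B k) i x y \<longrightarrow>
           run (N i) (x ! i) (y ! i) = f k) \<longrightarrow> (\<forall>i. isolates (J k) (A k) (B k) i x y \<longrightarrow>
           run (N i) (x ! i) (y ! i) = v) \<longrightarrow> R x y w)"
        by (rule solvable_mono[OF Cons.prems(4)[of "f(k := v)"]]) (use Cons.prems(1) in auto)
    qed (use Cons.prems in auto)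
  qed (use Cons.prems in auto)
  then show ?case by (simp add: add.assoc)
qed

section \<open>Decoding the sketch\<close>

definition sketch :: "nat \<Rightarrow> (nat \<Rightarrow> nat) \<Rightarrow> (nat \<times> 'a \<Rightarrow> nat) \<Rightarrow> 'a list \<Rightarrow> nat \<times> nat \<Rightarrow> int" where
  "sketch n b h x = (\<lambda>(k, w). \<Sum>j<n. of_bool (b j = k \<and> h (j, x ! j) = w))"

text \<open>\<open>edge (k, p, q)\<close> is the change of the sketch when a coordinate of bucket \<open>k\<close> changes its hash
  value from \<open>q\<close> to \<open>p\<close>. Edges with \<open>p = q\<close> vanish and serve as padding in \<open>edge_lists\<close>.\<close>

definition edge :: "nat \<times> nat \<times> nat \<Rightarrow> nat \<times> nat \<Rightarrow> int" where
  "edge = (\<lambda>(k, p, q) (k', w). of_bool (k' = k \<and> w = p) - of_bool (k' = k \<and> w = q))"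

definition edge_sum :: "(nat \<times> nat \<times> nat) list \<Rightarrow> nat \<times> nat \<Rightarrow> int" where
  "edge_sum L z = (\<Sum>e\<leftarrow>L. edge e z)"

definition active :: "(nat \<times> nat \<Rightarrow> int) \<Rightarrow> nat set" where
  "active d = {k. \<exists>w. d (k, w) \<noteq> 0}"

definition diffs :: "nat \<Rightarrow> 'a list \<Rightarrow> 'a list \<Rightarrow> nat set" where
  "diffs n x y = {i. i < n \<and> x ! i \<noteq> y ! i}"

lemma finite_diffs [simp]: "finite (diffs n x y)"
  by (simp add: diffs_def)

lemma sketch_minus_sketch:
  "sketch n b h x z - sketch n b h y z =
    (\<Sum>i\<in>diffs n x y. edge (b i, h (i, x ! i), h (i, y ! i)) z)"
proof -
  obtain k w where z: "z = (k, w)" by fastforce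
  have "sketch n b h x z - sketch n b h y z =
    (\<Sum>j<n. of_bool (b j = k \<and> h (j, x ! j) = w) - of_bool (b j = k \<and> h (j, y ! j) = w))"
    by (simp add: z sketch_def sum_subtractf)
  also have "\<dots> = (\<Sum>j\<in>diffs n x y. of_bool (b j = k \<and> h (j, x ! j) = w) - of_bool (b j = k \<and> h (j, y ! j) = w))"
    by (rule sum.mono_neutral_right) (auto simp: diffs_def)
  also have "\<dots> = (\<Sum>i\<in>diffs n x y. edge (b i, h (i, x ! i), h (i, y ! i)) z)"
    by (rule sum.cong) (auto simp: edge_def z)
  finally show ?thesis .
qed

lemma sum_edges_isolated:
  assumes "finite I" "inj_on b I" "i \<in> I"
  shows "(\<Sum>j\<in>I. edge (b j, p j, q j) (b i, w)) = of_bool (w = p i) - of_bool (w = q i)"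
proof -
  have "(\<Sum>j\<in>I. edge (b j, p j, q j) (b i, w)) = (\<Sum>j\<in>{i}. edge (b j, p j, q j) (b i, w))"
    by (rule sum.mono_neutral_right) (use assms in \<open>auto simp: edge_def inj_on_def\<close>)
  then show ?thesis by (simp add: edge_def)
qed

lemma sum_edges_outside:
  assumes "k \<notin> b ` I"
  shows "(\<Sum>j\<in>I. edge (b j, p j, q j) (k, w)) = 0"
  by (rule sum.neutral) (use assms in \<open>auto simp: edge_def\<close>)

lemma active_sum_edges_subset:
  "active (\<lambda>z. \<Sum>i\<in>I. edge (b i, p i, q i) z) \<subseteq> b ` I"
proof
  fix k assume "k \<in> active (\<lambda>z. \<Sum>i\<in>I. edge (b i, p i, q i) z)"
  then obtain w where "(\<Sum>i\<in>I. edge (b i, p i, q i) (k, w)) \<noteq> 0" by (auto simp: active_def)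
  then show "k \<in> b ` I" using sum_edges_outside[of k b I p q w] by blast
qed

lemma active_edge_sum_subset: "active (edge_sum L) \<subseteq> fst ` set L"
proof
  fix k assume "k \<in> active (edge_sum L)"
  then obtain w where w: "(\<Sum>e\<leftarrow>L. edge e (k, w)) \<noteq> 0"
    by (auto simp: active_def edge_sum_def)
  have "\<exists>e\<in>set L. edge e (k, w) \<noteq> 0"
  proof (rule ccontr)
    assume "\<not> ?thesis"
    then have "map (\<lambda>e. edge e (k, w)) L = map (\<lambda>e. 0) L" by (intro map_cong) auto
    with w show False by simp
  qed
  then obtain e where "e \<in> set L" "edge e (k, w) \<noteq> 0" by blast
  then have "k = fst e" by (cases "k = fst e") (auto simp: edge_def split: prod.splits)
  with \<open>e \<in> set L\<close> show "k \<in> fst ` set L" by blast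
qed

text \<open>With buckets and hash values below \<open>N\<close>, this covers all changes caused by
  at most \<open>r\<close> differing coordinates. Its cardinality governs both the length of Bob's
  reply and the union bound over fingerprint collisions.\<close>

definition edge_lists :: "nat \<Rightarrow> nat \<Rightarrow> (nat \<times> nat \<times> nat) list set" where
  "edge_lists N r = {L. set L \<subseteq> {..<N} \<times> {..<N} \<times> {..<N} \<and> length L = r}"

lemma finite_edge_lists: "finite (edge_lists N r)"
  unfolding edge_lists_def by (rule finite_lists_length_eq) auto

lemma card_edge_lists: "card (edge_lists N r) = (N * (N * N)) ^ r"
  unfolding edge_lists_def by (subst card_lists_length_eq) (auto simp: card_cartesian_product)

lemma card_active_edge_sum:
  assumes "L \<in> edge_lists N r"
  shows "finite (active (edge_sum L))" "card (active (edge_sum L)) \<le> r"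
proof -
  show "finite (active (edge_sum L))"
    using active_edge_sum_subset[of L] by (rule finite_subset) auto
  have "card (active (edge_sum L)) \<le> card (fst ` set L)"
    by (rule card_mono[OF _ active_edge_sum_subset]) auto
  also have "\<dots> \<le> length L"
    by (meson card_image_le card_length finite_set order_trans)
  finally show "card (active (edge_sum L)) \<le> r" using assms by (simp add: edge_lists_def)
qed

text \<open>The edges of the differing coordinates, padded by the vanishing edge
  \<open>(0, 0, 0)\<close>, form the list. Colliding buckets do no harm, since edges simply add
  up.\<close>

lemma edge_list_exists:
  assumes "card (diffs n x y) \<le> r" "N > 0" "\<And>j. j < n \<Longrightarrow> b j < N" "\<And>z. h z < N"
  shows "\<exists>L\<in>edge_lists N r. \<forall>z. sketch n b h y z + edge_sum L z = sketch n b h x z"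
proof -
  let ?e = "\<lambda>i. (b i, h (i, x ! i), h (i, y ! i))"
  define L where "L = map ?e (sorted_list_of_set (diffs n x y)) @
    replicate (r - card (diffs n x y)) (0, 0, 0)"
  have "L \<in> edge_lists N r"
    using assms by (auto simp: L_def edge_lists_def diffs_def)
  moreover have "edge_sum L z = (\<Sum>i\<in>diffs n x y. edge (?e i) z)" for z
  proof -
    have "(\<Sum>e\<leftarrow>replicate m (0, 0, 0). edge e z) = 0" for m
      by (induction m) (auto simp: edge_def split: prod.splits)
    then show ?thesis
      by (simp add: L_def edge_sum_def o_def sum_list_distinct_conv_sum_set)
  qed
  ultimately show ?thesis using sketch_minus_sketch[of n b h x _ y]
    by (intro bexI[of _ L]) (auto simp: algebra_simps)
qed

section \<open>Good randomness and correctness of decoding\<close>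

text \<open>Collects what decoding uses on the fixed inputs. The fingerprint condition makes any
  matching list the real change. The far case asks for more than \<open>r\<close> active buckets
  because a list of \<open>r\<close> edges can never explain these.\<close>

definition good ::
  "nat \<Rightarrow> ('a, 'a, 'v) comm_matrix list \<Rightarrow> nat \<Rightarrow> (nat \<times> 'a \<Rightarrow> nat) \<Rightarrow> (nat \<Rightarrow> nat) \<Rightarrow>
    ((nat \<times> nat \<Rightarrow> int) \<Rightarrow> nat) \<Rightarrow> (nat \<Rightarrow> ('a, 'a, 'v) protocol) \<Rightarrow> 'a list \<Rightarrow> 'a list \<Rightarrow> bool" where
  "good r Ps N h b F T x y \<longleftrightarrow>
    (let n = length Ps; I = diffs n x y in
      (\<forall>L\<in>edge_lists N r. F (\<lambda>z. sketch n b h y z + edge_sum L z) = F (sketch n b h x) \<longrightarrow>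
        (\<lambda>z. sketch n b h y z + edge_sum L z) = sketch n b h x) \<and>
      (if card I \<le> r then inj_on b I \<and> (\<forall>i\<in>I. h (i, x ! i) \<noteq> h (i, y ! i)) \<and>
         (\<forall>i\<in>I. run (T i) (x ! i) (y ! i) = entry (Ps ! i) (x ! i) (y ! i))
       else r < card (active (\<lambda>z. sketch n b h x z - sketch n b h y z))))"

text \<open>A matching list must be the true change of the sketch. Its active buckets then
  correspond one to one to the differing coordinates, and its signs assign the roles for the
  simulation.\<close>

lemma decode_correct:
  fixes Ps :: "('a, 'a, 'l) comm_matrix list"
  defines "n \<equiv> length Ps"
  assumes "perm_invariant r g" "L \<in> edge_lists N r"
    and good: "good r Ps N h b F T x y"
    and F: "F (\<lambda>z. sketch n b h y z + edge_sum L z) = F (sketch n b h x)"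
    and f: "\<forall>k\<in>active (edge_sum L). \<forall>i. isolates {j. j < n \<and> b j = k}
          (\<lambda>j z. edge_sum L (k, h (j, z)) = 1) (\<lambda>j z. edge_sum L (k, h (j, z)) = -1) i x y \<longrightarrow>
        run (T i) (x ! i) (y ! i) = f k"
  shows "entry (dist_comp r g Ps) x y = Some (g (map f (sorted_list_of_set (active (edge_sum L)))))"
proof -
  define I where "I = diffs n x y"
  have [simp]: "finite I" by (simp add: I_def)
  have "(\<lambda>z. sketch n b h y z + edge_sum L z) = sketch n b h x"
    using good F assms(3) by (auto simp: good_def n_def Let_def)
  then have d: "edge_sum L z = sketch n b h x z - sketch n b h y z" for z
    by (metis add_diff_cancel_left')
  have small: "card I \<le> r"
  proof (rule ccontr)
    assume "\<not> card I \<le> r"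
    then have "r < card (active (edge_sum L))"
      using good by (simp add: good_def n_def Let_def I_def d[abs_def])
    then show False using card_active_edge_sum[OF assms(3)] by simp
  qed
  then have inj: "inj_on b I" and sep: "\<And>i. i \<in> I \<Longrightarrow> h (i, x ! i) \<noteq> h (i, y ! i)"
    and T: "\<And>i. i \<in> I \<Longrightarrow> run (T i) (x ! i) (y ! i) = entry (Ps ! i) (x ! i) (y ! i)"
    using good by (auto simp: good_def n_def Let_def I_def)
  have d': "edge_sum L z = (\<Sum>i\<in>I. edge (b i, h (i, x ! i), h (i, y ! i)) z)" for z
    unfolding d sketch_minus_sketch I_def ..
  have at: "edge_sum L (b i, w) = of_bool (w = h (i, x ! i)) - of_bool (w = h (i, y ! i))"
    if "i \<in> I" for i w
    unfolding d' by (rule sum_edges_isolated[OF _ inj that]) simp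
  have act: "active (edge_sum L) = b ` I"
  proof
    show "active (edge_sum L) \<subseteq> b ` I"
      unfolding d'[abs_def] by (rule active_sum_edges_subset)
    show "b ` I \<subseteq> active (edge_sum L)"
    proof
      fix k assume "k \<in> b ` I"
      then obtain i where i: "i \<in> I" "k = b i" by blast
      then have "edge_sum L (k, h (i, x ! i)) \<noteq> 0" using at[OF i(1)] sep[OF i(1)] by simp
      then show "k \<in> active (edge_sum L)" unfolding active_def by blast
    qed
  qed
  have fb: "f (b i) = entry (Ps ! i) (x ! i) (y ! i)" if "i \<in> I" for i
  proof -
    \<comment> \<open>The change of the bucket is 1 at Alice's hash value for \<open>i\<close> and
      -1 at Bob's, and injectivity of \<open>b\<close> on \<open>I\<close> makes the players agree
      on the other coordinates of the bucket.\<close>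
    have "isolates {j. j < n \<and> b j = b i} (\<lambda>j z. edge_sum L (b i, h (j, z)) = 1)
      (\<lambda>j z. edge_sum L (b i, h (j, z)) = -1) i x y"
      using that sep[OF that] inj
      by (auto simp: isolates_def at[OF that] I_def diffs_def inj_on_def)
    moreover have "b i \<in> active (edge_sum L)" using that act by simp
    ultimately have "run (T i) (x ! i) (y ! i) = f (b i)" using f by blast
    then show ?thesis using T[OF that] by simp
  qed
  let ?is = "filter (\<lambda>i. x ! i \<noteq> y ! i) [0..<n]"
  have seq: "diff_seq Ps x y = map (\<lambda>i. entry (Ps ! i) (x ! i) (y ! i)) ?is"
  proof -
    have "concat (map (\<lambda>i. if P i then [f i] else []) js) = map f (filter P js)"
      for P js and f :: "nat \<Rightarrow> 'l"
      by (induction js) auto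
    then show ?thesis by (simp add: diff_seq_def n_def)
  qed
  have I_is: "set ?is = I" "distinct ?is" by (auto simp: I_def diffs_def)
  \<comment> \<open>The outputs come in the order of buckets instead of coordinates, so only the
    multisets can be compared.\<close>
  have "mset (map f (sorted_list_of_set (active (edge_sum L)))) = image_mset f (image_mset b (mset_set I))"
    using mset_set_set[of "sorted_list_of_set (b ` I)"]
    by (simp add: act image_mset_mset_set[OF inj])
  also have "\<dots> = image_mset (\<lambda>i. entry (Ps ! i) (x ! i) (y ! i)) (mset_set I)"
    by (simp add: multiset.map_comp o_def) (rule image_mset_cong, use fb in auto)
  also have "mset_set I = mset ?is" using I_is by (metis mset_set_set)
  finally have m: "mset (map f (sorted_list_of_set (active (edge_sum L)))) = mset (diff_seq Ps x y)"
    by (simp add: seq)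
  have "length (diff_seq Ps x y) \<le> r"
    using small I_is distinct_card[of ?is] by (simp add: seq)
  then have "g (diff_seq Ps x y) = g (map f (sorted_list_of_set (active (edge_sum L))))"
    using m assms(2) unfolding perm_invariant_def by metis
  then show ?thesis using small by (simp add: dist_comp_def I_def diffs_def n_def)
qed

text \<open>Alice sends the fingerprint of her sketch in \<open>s\<close> bits. Bob replies in
  \<open>Suc t\<close> bits with a list, the extra bit making room for \<open>None\<close>; then at
  most \<open>r\<close> blocks are simulated.\<close>

lemma solvable_dist_comp:
  fixes Ps :: "('a, 'a, 'l::finite) comm_matrix list"
  assumes "perm_invariant r g" "N > 0" "(N * (N * N)) ^ r \<le> 2 ^ t"
    and "\<And>j. j < length Ps \<Longrightarrow> cost (T j) \<le> m" "\<And>j. j < length Ps \<Longrightarrow> b j < N" "\<And>z. h z < N"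
    and "\<And>u. F u < 2 ^ s"
  shows "solvable (s + (Suc t + r * (2 * m + 2 * CARD('l))))
    (\<lambda>x y v. good r Ps N h b F T x y \<longrightarrow> v = entry (dist_comp r g Ps) x y)"
proof -
  define n where "n = length Ps"
  define print where "print x = F (sketch n b h x)" for x
  define cands where "cands c y = {L \<in> edge_lists N r. F (\<lambda>z. sketch n b h y z + edge_sum L z) = c}" for c y
  \<comment> \<open>Several lists may match. Any choice is fine, since under \<open>good\<close>
    each of them turns Bob's sketch into Alice's.\<close>
  define guess where "guess c y = (if cands c y = {} then None else Some (SOME L. L \<in> cands c y))" for c y
  have guess_Some: "L \<in> cands c y" if "guess c y = Some L" for c y L
    using that by (auto simp: guess_def some_in_eq split: if_splits)
  define S where "S = insert None (Some ` edge_lists N r)"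
  have S: "finite S" "card S \<le> 2 ^ Suc t"
  proof -
    show "finite S" using finite_edge_lists by (auto simp: S_def)
    have "card S \<le> Suc (card (edge_lists N r))"
      unfolding S_def by (metis card_image_le card_insert_le_m1 card_insert_if finite_edge_lists
          finite_imageI le_SucI Suc_le_mono)
    also have "\<dots> \<le> Suc (2 ^ t)" using assms(3) by (simp add: card_edge_lists)
    also have "\<dots> \<le> 2 ^ Suc t" by simp
    finally show "card S \<le> 2 ^ Suc t" .
  qed
  have guess_S: "guess c y \<in> S" for c y
    using guess_Some[of c y] by (cases "guess c y") (auto simp: S_def cands_def)
  let ?R = "\<lambda>x y v. good r Ps N h b F T x y \<longrightarrow> v = entry (dist_comp r g Ps) x y"
  have "solvable (r * (2 * m + 2 * CARD('l)))
     (\<lambda>x y v. guess c y = o' \<longrightarrow> print x = c \<longrightarrow> ?R x y v)" if "o' \<in> S" for c o'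
  proof (cases o')
    case None
    \<comment> \<open>Up to distance \<open>r\<close> the true list of changes would have matched,
      so a missing match reveals a larger distance.\<close>
    have "entry (dist_comp r g Ps) x y = None"
      if "good r Ps N h b F T x y" "guess c y = None" "print x = c" for x y
    proof (rule ccontr)
      assume "entry (dist_comp r g Ps) x y \<noteq> None"
      then have "card (diffs n x y) \<le> r"
        by (auto simp: dist_comp_def n_def diffs_def split: if_splits)
      then obtain L where "L \<in> edge_lists N r"
        and L: "\<forall>z. sketch n b h y z + edge_sum L z = sketch n b h x z"
        using edge_list_exists[of n x y r N b h] assms(2,5,6) n_def by blast
      moreover have "(\<lambda>z. sketch n b h y z + edge_sum L z) = sketch n b h x" using L by blast
      ultimately have "L \<in> cands c y"
        using that by (auto simp: cands_def print_def)
      then show False using that by (auto simp: guess_def split: if_splits)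
    qed
    then show ?thesis using None by (intro solvable_Output[of _ None]) auto
  next
    case (Some L)
    then have L: "L \<in> edge_lists N r" using that by (auto simp: S_def)
    let ?ks = "sorted_list_of_set (active (edge_sum L))"
    note act = card_active_edge_sum[OF L]
    have "solvable (length ?ks * (2 * m + 2 * CARD('l)) + 0)
     (\<lambda>x y v. guess c y = o' \<longrightarrow> print x = c \<longrightarrow> ?R x y v)"
    proof (rule solvable_simulate_list[of _ "\<lambda>k. {j. j < n \<and> b j = k}" T m _
          "\<lambda>k j z. edge_sum L (k, h (j, z)) = 1" "\<lambda>k j z. edge_sum L (k, h (j, z)) = -1"])
      fix f
      show "solvable 0 (\<lambda>x y w. (\<forall>k\<in>set ?ks. \<forall>i. isolates {j. j < n \<and> b j = k}
          (\<lambda>j z. edge_sum L (k, h (j, z)) = 1) (\<lambda>j z. edge_sum L (k, h (j, z)) = - 1) i x y \<longrightarrow>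
              run (T i) (x ! i) (y ! i) = f k) \<longrightarrow>
              guess c y = o' \<longrightarrow> print x = c \<longrightarrow> ?R x y w)"
      proof (rule solvable_Output[of _ "Some (g (map f ?ks))"], intro impI)
        fix x y
        assume *: "\<forall>k\<in>set ?ks. \<forall>i. isolates {j. j < n \<and> b j = k}
          (\<lambda>j z. edge_sum L (k, h (j, z)) = 1) (\<lambda>j z. edge_sum L (k, h (j, z)) = - 1) i x y \<longrightarrow>
              run (T i) (x ! i) (y ! i) = f k"
          "guess c y = o'" "print x = c" "good r Ps N h b F T x y"
        then have "L \<in> cands c y" using guess_Some Some by blast
        then have "F (\<lambda>z. sketch n b h y z + edge_sum L z) = F (sketch n b h x)"
          using * by (simp add: cands_def print_def)
        with * act show "Some (g (map f ?ks)) = entry (dist_comp r g Ps) x y"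
          by (intro decode_correct[OF assms(1) L, where T = T and F = F and h = h and b = b, symmetric])
            (auto simp: n_def)
      qed
    qed (use assms(4) n_def in auto)
    then show ?thesis by (rule solvable_mono) (use act in auto)
  qed
  then have "solvable (Suc t + r * (2 * m + 2 * CARD('l)))
      (\<lambda>x y v. guess c y \<in> S \<longrightarrow> print x = c \<longrightarrow> ?R x y v)" for c
    by (rule solvable_Bob_tells[OF S])
  then have "solvable (s + (Suc t + r * (2 * m + 2 * CARD('l))))
      (\<lambda>x y v. print x \<in> {..<2 ^ s} \<longrightarrow> ?R x y v)"
    by (intro solvable_Alice_tells) (auto simp: guess_S)
  then show ?thesis by (rule solvable_mono) (auto simp: print_def assms(7))
qed

section \<open>Random hashing\<close>

text \<open>A union bound for staged sampling: the second stage may depend on the first, and its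
  bound \<open>q\<close> is required only after good outcomes \<open>a\<close>.\<close>

lemma prob_bind_le:
  assumes "measure_pmf.prob p {a. B a} \<le> e" "0 \<le> q"
    and "\<And>a. a \<in> set_pmf p \<Longrightarrow> \<not> B a \<Longrightarrow> measure_pmf.prob (f a) X \<le> q"
  shows "measure_pmf.prob (bind_pmf p f) X \<le> e + q"
proof -
  have e: "0 \<le> e" using assms(1) measure_nonneg order_trans by blast
  have "emeasure (bind_pmf p f) X = (\<integral>\<^sup>+a. emeasure (f a) X \<partial>p)" by simp
  also have "\<dots> \<le> (\<integral>\<^sup>+a. indicator {a. B a} a + ennreal q \<partial>p)"
  proof (rule nn_integral_mono_AE, unfold AE_measure_pmf_iff, intro ballI)
    fix a assume "a \<in> set_pmf p"
    then show "emeasure (f a) X \<le> indicator {a. B a} a + ennreal q"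
      using assms(3)[of a] measure_pmf.prob_le_1[of "f a" X]
      by (cases "B a") (auto simp: measure_pmf.emeasure_eq_measure assms(2) add_increasing2
          simp flip: ennreal_1 intro: ennreal_leI)
  qed
  also have "\<dots> = emeasure p {a. B a} + ennreal q"
    by (simp add: nn_integral_add)
  also have "\<dots> \<le> ennreal (e + q)"
    using assms(1,2) e by (simp add: measure_pmf.emeasure_eq_measure ennreal_leI)
  finally show ?thesis
    using e assms(2) by (simp add: measure_pmf.emeasure_eq_measure flip: ennreal_plus)
qed

lemma prob_ex_le:
  fixes e :: real
  assumes "finite A" "\<And>i. i \<in> A \<Longrightarrow> measure_pmf.prob p {x. B i x} \<le> e"
  shows "measure_pmf.prob p {x. \<exists>i\<in>A. B i x} \<le> card A * e"
proof -
  have "{x. \<exists>i\<in>A. B i x} = (\<Union>i\<in>A. {x. B i x})" by blast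
  then have "measure_pmf.prob p {x. \<exists>i\<in>A. B i x} \<le> (\<Sum>i\<in>A. measure_pmf.prob p {x. B i x})"
    using measure_UNION_le[OF assms(1), of "\<lambda>i. {x. B i x}" "measure_pmf p"] by simp
  also have "\<dots> \<le> (\<Sum>i\<in>A. e)" by (rule sum_mono) (rule assms(2))
  finally show ?thesis by simp
qed

lemma prob_or_le:
  assumes "measure_pmf.prob p {x. A x} \<le> d" "measure_pmf.prob p {x. B x} \<le> e"
  shows "measure_pmf.prob p {x. A x \<or> B x} \<le> d + e"
proof -
  have "{x. A x \<or> B x} = {x. A x} \<union> {x. B x}" by blast
  then show ?thesis
    using measure_Un_le[of "{x. A x}" "measure_pmf p" "{x. B x}"] assms by simp
qed

lemma prob_mono:
  assumes "measure_pmf.prob p {x. B x} \<le> e" "\<And>x. A x \<Longrightarrow> B x"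
  shows "measure_pmf.prob p {x. A x} \<le> e"
  using assms(1) by (rule order_trans[rotated]) (auto intro!: measure_pmf.finite_measure_mono assms(2))

text \<open>The coordinates are independent, so \<open>i\<close> can be sampled last, after all the
  others have been fixed.\<close>

lemma prob_resample:
  assumes "finite A" "i \<in> A" "\<And>f. measure_pmf.prob (p i) {v. Q (f(i := v))} \<le> e"
  shows "measure_pmf.prob (Pi_pmf A d p) {f. Q f} \<le> e"
proof -
  have e: "0 \<le> e" using assms(3)[of undefined] measure_nonneg order_trans by blast
  have "Pi_pmf A d p = Pi_pmf (insert i (A - {i})) d p"
    using assms(2) by (simp add: insert_absorb)
  also have "\<dots> = bind_pmf (Pi_pmf (A - {i}) d p) (\<lambda>f. map_pmf (\<lambda>v. f(i := v)) (p i))"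
    using assms(1) by (subst Pi_pmf_insert') (auto simp: map_pmf_def bind_commute_pmf[of "p i"])
  finally have eq: "Pi_pmf A d p = \<dots>" .
  have "measure_pmf.prob (Pi_pmf A d p) {f. Q f} \<le> 0 + e"
    unfolding eq
  proof (rule prob_bind_le[where B = "\<lambda>_. False"])
    fix f
    show "measure_pmf.prob (map_pmf (\<lambda>v. f(i := v)) (p i)) {f. Q f} \<le> e"
      using assms(3)[of f] by (simp add: vimage_def)
  qed (use e in auto)
  then show ?thesis by simp
qed

abbreviation unif :: "nat \<Rightarrow> nat pmf" where
  "unif N \<equiv> pmf_of_set {..<N}"

lemma prob_unif_in:
  assumes "N > 0" "finite S"
  shows "measure_pmf.prob (unif N) {v. v \<in> S} \<le> card S / N"
proof -
  have "card ({..<N} \<inter> S) \<le> card S" using assms by (intro card_mono) auto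
  then show ?thesis using assms by (subst measure_pmf_of_set) (auto simp: divide_right_mono lessThan_empty_iff)
qed

lemma prob_unif_eq: "N > 0 \<Longrightarrow> measure_pmf.prob (unif N) {v. v = c} \<le> 1 / N"
  using prob_unif_in[of N "{c}"] by simp

lemma unif_Pi_less:
  assumes "finite A" "N > 0" "f \<in> set_pmf (Pi_pmf A 0 (\<lambda>_. unif N))"
  shows "f z < N"
proof -
  have "f \<in> PiE_dflt A 0 (\<lambda>_. {..<N})"
    using assms set_pmf_of_set[of "{..<N}"] by (simp add: set_Pi_pmf o_def lessThan_empty_iff)
  then show ?thesis using assms(2) by (cases "z \<in> A") (auto simp: PiE_dflt_def)
qed

lemma prob_unif_collision:
  assumes "finite A" "N > 0" "z \<in> A" "z \<noteq> z'"
  shows "measure_pmf.prob (Pi_pmf A 0 (\<lambda>_. unif N)) {f. f z = f z'} \<le> 1 / N"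
  by (rule prob_resample[OF assms(1,3)]) (use assms prob_unif_eq in auto)

text \<open>At distance larger than \<open>r\<close>, fix a set \<open>I'\<close> of \<open>r + 1\<close> differing coordinates. The contribution
  \<open>d\<close> of the other coordinates does not depend on the buckets of \<open>I'\<close>: either it already occupies so
  many buckets that \<open>I'\<close> cannot cancel enough of them, or the buckets of \<open>I'\<close> most likely avoid it.\<close>

lemma prob_bad_buckets:
  fixes h :: "nat \<times> 'a \<Rightarrow> nat"
  assumes "N > 0" "I' \<subseteq> diffs n x y"
    and I': "I' = diffs n x y \<and> card I' \<le> r \<or> card I' = Suc r"
    and sep: "\<And>i. i \<in> I' \<Longrightarrow> h (i, x ! i) \<noteq> h (i, y ! i)"
  shows "measure_pmf.prob (Pi_pmf {..<n} 0 (\<lambda>_. unif N))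
    {b. \<not> (if card (diffs n x y) \<le> r then inj_on b (diffs n x y)
           else r < card (active (\<lambda>z. sketch n b h x z - sketch n b h y z)))}
    \<le> Suc r * (Suc r / N) + Suc r * (real (2 * r + 1) / N)"
proof -
  let ?p = "Pi_pmf {..<n} 0 (\<lambda>_. unif N)"
  define I where "I = diffs n x y"
  define e where "e b i = edge (b i, h (i, x ! i), h (i, y ! i))" for b i
  define d where "d b z = (\<Sum>i\<in>I - I'. e b i z)" for b z
  have fin: "finite I'" "finite I"
    using finite_subset[OF assms(2)] by (simp_all add: I_def)
  have sub: "I' \<subseteq> {..<n}" using assms(2) by (auto simp: diffs_def)
  have card_I': "card I' \<le> Suc r" using I' by auto
  have "measure_pmf.prob ?p {b. \<exists>i\<in>I'. \<exists>j\<in>I' - {i}. b i = b j} \<le> card I' * (Suc r / N)"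
  proof (rule prob_ex_le[OF fin(1)])
    fix i assume i: "i \<in> I'"
    have "measure_pmf.prob ?p {b. \<exists>j\<in>I' - {i}. b i = b j} \<le> card (I' - {i}) * (1 / N)"
      by (rule prob_ex_le) (use fin sub i assms(1) in \<open>auto intro!: prob_unif_collision\<close>)
    also have "\<dots> \<le> Suc r / N"
      using card_I' card_Diff1_le[of I' i] by (simp add: divide_right_mono)
    finally show "measure_pmf.prob ?p {b. \<exists>j\<in>I' - {i}. b i = b j} \<le> Suc r / N" .
  qed
  also have "\<dots> \<le> Suc r * (Suc r / N)" by (rule mult_right_mono) (use card_I' in auto)
  finally have 1: "measure_pmf.prob ?p {b. \<exists>i\<in>I'. \<exists>j\<in>I' - {i}. b i = b j} \<le> Suc r * (Suc r / N)" .
  have fin_d: "finite (active (d b))" for b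
    using active_sum_edges_subset[of b] fin unfolding d_def e_def
    by (meson finite_Diff finite_imageI finite_subset)
  \<comment> \<open>Only a small set of occupied buckets can be avoided with high probability, hence
    the cutoff \<open>2 * r + 1\<close>.\<close>
  have "measure_pmf.prob ?p {b. \<exists>i\<in>I'. b i \<in> active (d b) \<and> card (active (d b)) \<le> 2 * r + 1}
    \<le> card I' * (real (2 * r + 1) / N)"
  proof (rule prob_ex_le[OF fin(1)])
    fix i assume i: "i \<in> I'"
    show "measure_pmf.prob ?p {b. b i \<in> active (d b) \<and> card (active (d b)) \<le> 2 * r + 1} \<le> real (2 * r + 1) / N"
    proof (rule prob_resample)
      fix b
      \<comment> \<open>Coordinate \<open>i\<close> lies in \<open>I'\<close> and contributes
        nothing to \<open>d\<close>, so the occupied buckets stay fixed while the bucket of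
        \<open>i\<close> is resampled.\<close>
      have "d (b(i := v)) = d b" for v
        unfolding d_def[abs_def] e_def using i by (intro ext sum.cong) auto
      then have "measure_pmf.prob (unif N) {v. (b(i := v)) i \<in> active (d (b(i := v))) \<and>
          card (active (d (b(i := v)))) \<le> 2 * r + 1} =
        measure_pmf.prob (unif N) {v. v \<in> active (d b) \<and> card (active (d b)) \<le> 2 * r + 1}" by simp
      also have "\<dots> \<le> real (2 * r + 1) / N"
      proof (cases "card (active (d b)) \<le> 2 * r + 1")
        case True
        have "measure_pmf.prob (unif N) {v. v \<in> active (d b)} \<le> card (active (d b)) / N"
          using assms(1) fin_d by (rule prob_unif_in)
        also have "\<dots> \<le> real (2 * r + 1) / N" using True by (intro divide_right_mono) auto
        finally show ?thesis using True by simp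
      qed simp
      finally show "measure_pmf.prob (unif N) {v. (b(i := v)) i \<in> active (d (b(i := v))) \<and>
          card (active (d (b(i := v)))) \<le> 2 * r + 1} \<le> real (2 * r + 1) / N" .
    qed (use i sub in auto)
  qed
  also have "\<dots> \<le> Suc r * (real (2 * r + 1) / N)" by (rule mult_right_mono) (use card_I' in auto)
  finally have 2: "measure_pmf.prob ?p {b. \<exists>i\<in>I'. b i \<in> active (d b) \<and> card (active (d b)) \<le> 2 * r + 1}
    \<le> Suc r * (real (2 * r + 1) / N)" .
  show ?thesis
  proof (rule prob_mono[OF prob_or_le[OF 1 2]], rule ccontr)
    fix b
    assume bad: "\<not> (if card (diffs n x y) \<le> r then inj_on b (diffs n x y)
           else r < card (active (\<lambda>z. sketch n b h x z - sketch n b h y z)))"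
      and ok: "\<not> ((\<exists>i\<in>I'. \<exists>j\<in>I' - {i}. b i = b j) \<or>
        (\<exists>i\<in>I'. b i \<in> active (d b) \<and> card (active (d b)) \<le> 2 * r + 1))"
    have inj: "inj_on b I'" using ok by (auto simp: inj_on_def)
    show False
    proof (cases "card I \<le> r")
      case True
      then have "I' = I" using I' assms(2) fin card_mono[of I I'] by (auto simp: I_def)
      then show False using bad True inj by (simp add: I_def)
    next
      case False
      then have c: "card I' = Suc r" using I' by (auto simp: I_def)
      define D where "D z = sketch n b h x z - sketch n b h y z" for z
      define d' where "d' z = (\<Sum>i\<in>I'. e b i z)" for z
      have D: "D z = d' z + d b z" for z
        unfolding D_def sketch_minus_sketch d'_def d_def e_def
        using sum.subset_diff[OF assms(2)] fin by (simp add: I_def add.commute)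
      have "active D \<subseteq> b ` I"
        unfolding D_def sketch_minus_sketch I_def by (rule active_sum_edges_subset)
      then have finD: "finite (active D)" using fin finite_subset by blast
      have act': "active d' \<subseteq> b ` I'" unfolding d'_def e_def by (rule active_sum_edges_subset)
      have "r < card (active D)"
      proof (cases "card (active (d b)) \<le> 2 * r + 1")
        case True
        have "b ` I' \<subseteq> active D"
        proof
          fix k assume "k \<in> b ` I'"
          then obtain i where i: "i \<in> I'" "k = b i" by blast
          have "d' (k, h (i, x ! i)) = 1"
            unfolding d'_def e_def i(2) sum_edges_isolated[OF fin(1) inj i(1)]
            using sep[OF i(1)] by simp
          moreover have "d b (k, h (i, x ! i)) = 0"
            using ok True i by (auto simp: active_def)
          ultimately have "D (k, h (i, x ! i)) \<noteq> 0" by (simp add: D)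
          then show "k \<in> active D" unfolding active_def by blast
        qed
        then have "card (b ` I') \<le> card (active D)" using finD by (intro card_mono)
        then show ?thesis using c card_image[OF inj] by simp
      next
        case False
        \<comment> \<open>At least \<open>2 * r + 2\<close> buckets are active in
          \<open>d b\<close>, and the \<open>r + 1\<close> coordinates of \<open>I'\<close> can
          cancel no more than \<open>r + 1\<close> of them; more than \<open>r\<close>
          remain.\<close>
        have "active (d b) \<subseteq> active D \<union> active d'"
          using D unfolding active_def by force
        then have "active (d b) \<subseteq> active D \<union> b ` I'" using act' by blast
        then have "card (active (d b)) \<le> card (active D \<union> b ` I')"
          using finD fin by (intro card_mono) auto
        also have "\<dots> \<le> card (active D) + Suc r"
          using card_Un_le[of "active D" "b ` I'"] card_image_le[OF fin(1), of b] c by linarith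
        finally show ?thesis using False by simp
      qed
      then show False using bad False by (simp add: I_def D_def[abs_def])
    qed
  qed
qed

section \<open>Randomized cost\<close>

lemma rand_cost_leI:
  assumes "computes_with_error D P \<delta>" "\<And>T. T \<in> set_pmf D \<Longrightarrow> cost T \<le> c"
  shows "rand_cost \<delta> P \<le> enat c"
  unfolding rand_cost_def by (rule INF_lower) (use assms in blast)

text \<open>The infimum ranges over natural numbers: without a protocol of cost at most
  \<open>c\<close>, every admissible cost and thus the infimum would be at least
  \<open>c + 1\<close>.\<close>

lemma rand_cost_leD:
  assumes "rand_cost \<delta> P \<le> enat c"
  obtains D where "computes_with_error D P \<delta>" "\<And>T. T \<in> set_pmf D \<Longrightarrow> cost T \<le> c"
proof (rule ccontr)
  assume none: "\<not> thesis"
  have "enat (Suc c) \<le> rand_cost \<delta> P"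
    unfolding rand_cost_def
  proof (rule INF_greatest)
    fix c' assume "c' \<in> {c. \<exists>D. computes_with_error D P \<delta> \<and> (\<forall>T\<in>set_pmf D. cost T \<le> c)}"
    then obtain D where "computes_with_error D P \<delta>" "\<forall>T\<in>set_pmf D. cost T \<le> c'" by blast
    then have "\<not> c' \<le> c" using none that le_trans by blast
    then show "enat (Suc c) \<le> enat c'" by simp
  qed
  with assms have "enat (Suc c) \<le> enat c" by (rule order_trans[rotated])
  then show False by simp
qed

text \<open>Reduces a cost bound to deterministic trees: one is chosen for every outcome of the
  public coins, and it can err only where \<open>G\<close> fails.\<close>

lemma rand_cost_le_solvable:
  assumes "\<And>\<omega>. \<omega> \<in> set_pmf p \<Longrightarrow> solvable c (\<lambda>x y v. G \<omega> x y \<longrightarrow> v = entry P x y)"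
    and "\<And>x y. x \<in> row_set P \<Longrightarrow> y \<in> col_set P \<Longrightarrow> measure_pmf.prob p {\<omega>. \<not> G \<omega> x y} \<le> \<delta>"
  shows "rand_cost \<delta> P \<le> enat c"
proof -
  obtain prot where prot: "\<And>\<omega>. \<omega> \<in> set_pmf p \<Longrightarrow> cost (prot \<omega>) \<le> c"
    "\<And>\<omega> x y. \<omega> \<in> set_pmf p \<Longrightarrow> G \<omega> x y \<Longrightarrow> run (prot \<omega>) x y = entry P x y"
    using assms(1) unfolding solvable_def by metis
  show ?thesis
  proof (rule rand_cost_leI[of "map_pmf prot p"])
    show "computes_with_error (map_pmf prot p) P \<delta>"
      unfolding computes_with_error_def
    proof (intro ballI)
      fix x y assume xy: "x \<in> row_set P" "y \<in> col_set P"
      have "measure_pmf.prob (map_pmf prot p) {T. run T x y \<noteq> entry P x y} \<le> \<delta> + 0"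
        unfolding map_pmf_def
        by (rule prob_bind_le[OF assms(2)[OF xy]]) (auto simp: prot(2))
      then show "measure_pmf.prob (map_pmf prot p) {T. run T x y \<noteq> entry P x y} \<le> \<delta>" by simp
    qed
  qed (use prot(1) in auto)
qed

lemma rand_cost_guess:
  fixes P :: "('a, 'b, 'v::finite) comm_matrix"
  assumes "1 - 1 / CARD('v) \<le> \<delta>"
  shows "rand_cost \<delta> P = 0"
proof -
  have "rand_cost \<delta> P \<le> enat 0"
  proof (rule rand_cost_le_solvable[of "pmf_of_set UNIV" 0 "\<lambda>v x y. v = entry P x y"])
    fix x y
    have "measure_pmf.prob (pmf_of_set UNIV) {v. v \<noteq> entry P x y} = real (card (UNIV - {entry P x y})) / CARD('v)"
      by (subst measure_pmf_of_set) (auto simp: Collect_neg_eq Compl_eq_Diff_UNIV)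
    also have "\<dots> = 1 - 1 / CARD('v)"
      by (simp add: card_Diff_singleton of_nat_diff Suc_le_eq field_simps)
    finally show "measure_pmf.prob (pmf_of_set UNIV) {v. v \<noteq> entry P x y} \<le> \<delta>"
      using assms by simp
  qed (auto intro: solvable_Output)
  then show ?thesis by (simp flip: zero_enat_def)
qed

section \<open>Error reduction by majority vote\<close>

text \<open>A Chernoff bound by exponential moments: with weight 3 per error, each factor has
  expectation at most 3/2, and Markov's inequality at \<open>3 ^ s\<close> yields
  \<open>(9 / 4) ^ s / 3 ^ s\<close>.\<close>

lemma prob_many_errors:
  assumes "measure_pmf.prob D {T. E T} \<le> 1 / 4"
  shows "measure_pmf.prob (Pi_pmf {..<2 * s} d (\<lambda>_. D)) {T. s \<le> card {j. j < 2 * s \<and> E (T j)}} \<le> (3 / 4) ^ s"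
proof -
  let ?p = "Pi_pmf {..<2 * s} d (\<lambda>_. D)"
  let ?w = "\<lambda>T. if E T then 3 else 1 :: real"
  let ?u = "\<lambda>T. \<Prod>j<2 * s. ?w (T j)"
  have bnd: "integrable (measure_pmf q) f" if "\<And>x. \<bar>f x\<bar> \<le> c" for q :: "'c pmf" and f :: "'c \<Rightarrow> real" and c
    by (rule measure_pmf.integrable_const_bound[where B = c]) (auto simp: that)
  have u: "?u T = 3 ^ card {j. j < 2 * s \<and> E (T j)}" for T
  proof -
    have "{..<2 * s} \<inter> {j. E (T j)} = {j. j < 2 * s \<and> E (T j)}" by auto
    then show ?thesis by (subst prod.If_cases) auto
  qed
  have "measure_pmf.expectation D ?w = measure_pmf.expectation D (\<lambda>T. 1 + 2 * indicator {T. E T} T)"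
    by (rule arg_cong[where f = "measure_pmf.expectation D"]) (auto simp: indicator_def)
  also have "\<dots> = 1 + 2 * measure_pmf.prob D {T. E T}"
  proof -
    have "integrable D (\<lambda>T. 2 * indicator {T. E T} T :: real)"
      by (rule bnd[of _ 2]) (simp add: indicator_def)
    then show ?thesis by simp
  qed
  finally have w: "measure_pmf.expectation D ?w \<le> 3 / 2" using assms by simp
  have w0: "0 \<le> measure_pmf.expectation D ?w" by (rule Bochner_Integration.integral_nonneg) auto
  have "measure_pmf.expectation ?p ?u = (\<Prod>j<2 * s. measure_pmf.expectation D ?w)"
    by (rule expectation_prod_Pi_pmf) (auto intro!: bnd[of _ 3])
  also have "\<dots> \<le> (3 / 2) ^ (2 * s)"
    using power_mono[OF w w0] by simp
  finally have Eu: "measure_pmf.expectation ?p ?u \<le> (3 / 2) ^ (2 * s)" .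
  have "measure_pmf.prob ?p {T \<in> space ?p. ?u T \<ge> 3 ^ s} \<le> measure_pmf.expectation ?p ?u / 3 ^ s"
  proof (rule integral_Markov_inequality_measure[where A = UNIV])
    show "integrable (measure_pmf ?p) ?u"
      unfolding u
    proof (rule bnd[of _ "3 ^ (2 * s)"])
      fix T :: "nat \<Rightarrow> 'a"
      have "card {j. j < 2 * s \<and> E (T j)} \<le> card {..<2 * s}" by (rule card_mono) auto
      then show "\<bar>3 ^ card {j. j < 2 * s \<and> E (T j)}\<bar> \<le> (3 ^ (2 * s) :: real)"
        by (simp add: power_increasing)
    qed
  qed (auto intro!: AE_I2 prod_nonneg)
  also have "\<dots> \<le> (3 / 2) ^ (2 * s) / 3 ^ s" using Eu by (rule divide_right_mono) simp
  also have "\<dots> = ((3 / 2) ^ 2 / 3) ^ s" by (simp only: power_mult power_divide)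
  also have "(3 / 2) ^ 2 / 3 = (3 / 4 :: real)" by (simp add: power2_eq_square)
  finally show ?thesis unfolding u by simp
qed

lemma solvable_run_all:
  assumes "\<And>j. j < t \<Longrightarrow> cost (T j) \<le> m"
    and "\<And>f. solvable c (\<lambda>x y w. (\<forall>j<t. run (T j) x y = f j) \<longrightarrow> R x y w)"
  shows "solvable (t * m + c) R"
  using assms
proof (induction t arbitrary: R)
  case 0
  then show ?case by simp
next
  case (Suc t)
  have "solvable (m + (t * m + c)) R"
  proof (rule solvable_run[of "T t"])
    fix v
    show "solvable (t * m + c) (\<lambda>x y w. run (T t) x y = v \<longrightarrow> R x y w)"
    proof (rule Suc.IH)
      fix f
      show "solvable c (\<lambda>x y w. (\<forall>j<t. run (T j) x y = f j) \<longrightarrow> run (T t) x y = v \<longrightarrow> R x y w)"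
      proof (rule solvable_mono[OF Suc.prems(2)[of "f(t := v)"]], goal_cases)
        case (2 x y w)
        have "\<forall>j<Suc t. run (T j) x y = (f(t := v)) j"
          if "\<forall>j<t. run (T j) x y = f j" "run (T t) x y = v"
          using that by (auto simp: less_Suc_eq)
        with 2 show ?case by blast
      qed simp
    qed (use Suc.prems in auto)
  qed (use Suc.prems in auto)
  then show ?case by (simp add: add.assoc)
qed

text \<open>Running all \<open>t\<close> protocols makes their outputs \<open>f\<close> public. Two
  different values cannot both have fewer than half of the outputs against them, so the winner is
  determined by \<open>f\<close> alone.\<close>

lemma solvable_majority:
  assumes "\<And>j. j < t \<Longrightarrow> cost (T j) \<le> m"
  shows "solvable (t * m) (\<lambda>x y w. 2 * card {j. j < t \<and> run (T j) x y \<noteq> z x y} < t \<longrightarrow> w = z x y)"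
proof -
  have "solvable (t * m + 0) (\<lambda>x y w. 2 * card {j. j < t \<and> run (T j) x y \<noteq> z x y} < t \<longrightarrow> w = z x y)"
  proof (rule solvable_run_all[of _ T])
    fix f :: "nat \<Rightarrow> 'c"
    define maj where "maj v \<longleftrightarrow> 2 * card {j. j < t \<and> f j \<noteq> v} < t" for v
    have unique: "v = v'" if "maj v" "maj v'" for v v'
    proof (rule ccontr)
      assume "v \<noteq> v'"
      then have "{..<t} = {j. j < t \<and> f j \<noteq> v} \<union> {j. j < t \<and> f j \<noteq> v'}" by auto
      then have "t = card ({j. j < t \<and> f j \<noteq> v} \<union> {j. j < t \<and> f j \<noteq> v'})"
        by (metis card_lessThan)
      also have "\<dots> \<le> card {j. j < t \<and> f j \<noteq> v} + card {j. j < t \<and> f j \<noteq> v'}"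
        by (rule card_Un_le)
      finally show False using that by (simp add: maj_def)
    qed
    have "(SOME v. maj v) = z x y"
      if "\<forall>j<t. run (T j) x y = f j" "2 * card {j. j < t \<and> run (T j) x y \<noteq> z x y} < t" for x y
    proof -
      have "{j. j < t \<and> run (T j) x y \<noteq> z x y} = {j. j < t \<and> f j \<noteq> z x y}" using that(1) by auto
      then have "maj (z x y)" using that(2) by (simp add: maj_def)
      then show ?thesis using unique by (metis someI)
    qed
    then show "solvable 0 (\<lambda>x y w. (\<forall>j<t. run (T j) x y = f j) \<longrightarrow>
        2 * card {j. j < t \<and> run (T j) x y \<noteq> z x y} < t \<longrightarrow> w = z x y)"
      by (intro solvable_Output[of _ "SOME v. maj v"]) auto
  qed (use assms in auto)
  then show ?thesis by simp
qed

lemma rand_cost_amplify: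
  assumes "rand_cost (1 / 4) P \<le> enat m"
  shows "rand_cost ((3 / 4) ^ s) P \<le> enat (2 * s * m)"
proof (rule rand_cost_leD[OF assms])
  fix D assume D: "computes_with_error D P (1 / 4)" "\<And>T. T \<in> set_pmf D \<Longrightarrow> cost T \<le> m"
  show ?thesis
  proof (rule rand_cost_le_solvable[where p = "Pi_pmf {..<2 * s} undefined (\<lambda>_. D)" and
        G = "\<lambda>T x y. 2 * card {j. j < 2 * s \<and> run (T j) x y \<noteq> entry P x y} < 2 * s"])
    fix T assume "T \<in> set_pmf (Pi_pmf {..<2 * s} undefined (\<lambda>_. D))"
    then have "cost (T j) \<le> m" if "j < 2 * s" for j
      using that D(2) by (auto simp: set_Pi_pmf PiE_dflt_def)
    then show "solvable (2 * s * m) (\<lambda>x y v. 2 * card {j. j < 2 * s \<and> run (T j) x y \<noteq> entry P x y} < 2 * s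
        \<longrightarrow> v = entry P x y)"
      by (rule solvable_majority)
  next
    fix x y assume "x \<in> row_set P" "y \<in> col_set P"
    then have "measure_pmf.prob D {T. run T x y \<noteq> entry P x y} \<le> 1 / 4"
      using D(1) by (simp add: computes_with_error_def)
    from prob_many_errors[OF this, of s undefined]
    show "measure_pmf.prob (Pi_pmf {..<2 * s} undefined (\<lambda>_. D))
        {T. \<not> 2 * card {j. j < 2 * s \<and> run (T j) x y \<noteq> entry P x y} < 2 * s} \<le> (3 / 4) ^ s"
      by (simp add: not_less)
  qed
qed

text \<open>Whenever \<open>v L\<close> differs from \<open>u\<close>, the value
  \<open>F (v L)\<close> is uniform given the rest of \<open>F\<close>. The point \<open>u\<close>
  may lie outside \<open>U\<close>, where \<open>F\<close> takes the default 0; a match still has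
  probability at most \<open>1 / M\<close>.\<close>

lemma prob_fingerprint_collision:
  assumes "finite Ls" "finite U" "M > 0" "\<And>L. L \<in> Ls \<Longrightarrow> v L \<in> U"
  shows "measure_pmf.prob (Pi_pmf U 0 (\<lambda>_. unif M)) {F. \<not> (\<forall>L\<in>Ls. F (v L) = F u \<longrightarrow> v L = u)}
    \<le> card Ls / M"
proof -
  have "measure_pmf.prob (Pi_pmf U 0 (\<lambda>_. unif M)) {F. \<exists>L\<in>Ls. F (v L) = F u \<and> v L \<noteq> u}
    \<le> card Ls * (1 / M)"
  proof (rule prob_ex_le[OF assms(1)])
    fix L assume "L \<in> Ls"
    then show "measure_pmf.prob (Pi_pmf U 0 (\<lambda>_. unif M)) {F. F (v L) = F u \<and> v L \<noteq> u} \<le> 1 / M"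
      by (cases "v L = u") (auto intro!: prob_unif_collision assms)
  qed
  moreover have "{F. \<exists>L\<in>Ls. F (v L) = F u \<and> v L \<noteq> u} = {F. \<not> (\<forall>L\<in>Ls. F (v L) = F u \<longrightarrow> v L = u)}" by blast
  ultimately show ?thesis by simp
qed

lemma finite_tuples:
  assumes "\<And>A. A \<in> set As \<Longrightarrow> finite A"
  shows "finite (tuples As)"
proof (rule finite_subset)
  show "tuples As \<subseteq> {xs. set xs \<subseteq> \<Union> (set As) \<and> length xs = length As}"
  proof
    fix xs assume xs: "xs \<in> tuples As"
    then have "xs ! i \<in> \<Union> (set As)" if "i < length xs" for i
      using that nth_mem[of i As] unfolding tuples_def by auto
    then have "set xs \<subseteq> \<Union> (set As)" unfolding set_conv_nth[of xs] by blast
    then show "xs \<in> {xs. set xs \<subseteq> \<Union> (set As) \<and> length xs = length As}"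
      using xs by (simp add: tuples_def)
  qed
  show "finite {xs. set xs \<subseteq> \<Union> (set As) \<and> length xs = length As}"
    by (rule finite_lists_length_eq) (use assms in auto)
qed

section \<open>The protocol for the composition\<close>

text \<open>Bucket indices and hash values have \<open>a\<close> bits. With \<open>2 ^ a\<close> at
  least \<open>60 * r ^ 2 / \<delta>\<close>, all hashing errors together use up a constant fraction
  of \<open>\<delta>\<close>, and the component protocols another tenth.\<close>

lemma rand_cost_dist_comp:
  fixes Ps :: "('a, 'a, 'l::finite) comm_matrix list"
  assumes fin: "\<And>P. P \<in> set Ps \<Longrightarrow> finite_matrix P"
    and g: "perm_invariant r g" and r: "r \<ge> 1" and \<delta>: "0 < \<delta>"
    and m: "\<And>P. P \<in> set Ps \<Longrightarrow> rand_cost (\<delta> / (10 * real r)) P \<le> enat m"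
    and a: "60 * real r ^ 2 / \<delta> \<le> 2 ^ a"
  shows "rand_cost \<delta> (dist_comp r g Ps) \<le>
    enat (a * (3 * r + 1) + (Suc (3 * a * r) + r * (2 * m + 2 * CARD('l))))"
proof -
  define n where "n = length Ps"
  define N :: nat where "N = 2 ^ a"
  \<comment> \<open>There are \<open>N ^ (3 * r)\<close> candidate lists, so
    \<open>N ^ (3 * r + 1)\<close> fingerprints bring the collision probability down to
    \<open>1 / N\<close>.\<close>
  define s where "s = a * (3 * r + 1)"
  define V where "V = (\<Union>P\<in>set Ps. row_set P \<union> col_set P)"
  define Y where "Y = tuples (map col_set Ps)"
  define Ls where "Ls = edge_lists N r"
  \<comment> \<open>A finite domain for the random fingerprint that contains every vector Bob may
    test, whatever his input.\<close>
  define U where "U h b = (\<lambda>(y, L) z. sketch n b h y z + edge_sum L z) ` (Y \<times> Ls)"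
    for h :: "nat \<times> 'a \<Rightarrow> nat" and b
  have N: "N > 0" by (simp add: N_def)
  have finV: "finite V" using fin by (auto simp: V_def finite_matrix_def)
  have "finite Y" using fin by (auto simp: Y_def finite_matrix_def intro!: finite_tuples)
  then have finU: "finite (U h b)" for h b
    by (simp add: U_def Ls_def finite_edge_lists)
  have "\<forall>j\<in>{..<n}. \<exists>D. computes_with_error D (Ps ! j) (\<delta> / (10 * real r)) \<and> (\<forall>T\<in>set_pmf D. cost T \<le> m)"
    using m rand_cost_leD unfolding n_def by (metis lessThan_iff nth_mem)
  then obtain D where D: "\<And>j. j < n \<Longrightarrow> computes_with_error (D j) (Ps ! j) (\<delta> / (10 * real r))"
    "\<And>j T. j < n \<Longrightarrow> T \<in> set_pmf (D j) \<Longrightarrow> cost T \<le> m"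
    by (metis lessThan_iff)
  define ph where "ph = Pi_pmf ({..<n} \<times> V) 0 (\<lambda>_. unif N)"
  define pb where "pb = Pi_pmf {..<n} 0 (\<lambda>_. unif N)"
  define pF where "pF h b = Pi_pmf (U h b) 0 (\<lambda>_. unif (2 ^ s))" for h b
  define pT where "pT = Pi_pmf {..<n} undefined D"
  define p where "p = bind_pmf ph (\<lambda>h. bind_pmf pb (\<lambda>b. bind_pmf (pF h b) (\<lambda>F.
    bind_pmf pT (\<lambda>T. return_pmf (h, b, F, T)))))"
  let ?G = "\<lambda>(h, b, F, T) x y. good r Ps N h b F T x y"
  show ?thesis
    unfolding s_def[symmetric]
  proof (rule rand_cost_le_solvable[where p = p and G = ?G])
    fix \<omega> assume "\<omega> \<in> set_pmf p"
    then obtain h b F T where \<omega>: "\<omega> = (h, b, F, T)" and hbFT: "h \<in> set_pmf ph" "b \<in> set_pmf pb"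
      "F \<in> set_pmf (pF h b)" "T \<in> set_pmf pT"
      by (auto simp: p_def)
    have "solvable (s + (Suc (3 * a * r) + r * (2 * m + 2 * CARD('l))))
      (\<lambda>x y v. good r Ps N h b F T x y \<longrightarrow> v = entry (dist_comp r g Ps) x y)"
    proof (rule solvable_dist_comp[OF g N])
      show "(N * (N * N)) ^ r \<le> 2 ^ (3 * a * r)"
        by (simp add: N_def power_mult[symmetric] power_add[symmetric] algebra_simps)
      show "cost (T j) \<le> m" if "j < length Ps" for j
        using that hbFT(4) D(2)[of j] by (auto simp: pT_def set_Pi_pmf PiE_dflt_def n_def)
      show "h z < N" for z
        by (rule unif_Pi_less[OF _ N hbFT(1)[unfolded ph_def]]) (simp add: finV)
      show "b j < N" for j
        by (rule unif_Pi_less[OF _ N hbFT(2)[unfolded pb_def]]) simp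
      show "F u < 2 ^ s" for u
        by (rule unif_Pi_less[OF finU _ hbFT(3)[unfolded pF_def]]) simp
    qed
    then show "solvable (s + (Suc (3 * a * r) + r * (2 * m + 2 * CARD('l))))
      (\<lambda>x y v. ?G \<omega> x y \<longrightarrow> v = entry (dist_comp r g Ps) x y)"
      by (simp add: \<omega>)
  next
    fix x y
    assume "x \<in> row_set (dist_comp r g Ps)" "y \<in> col_set (dist_comp r g Ps)"
    then have x: "x \<in> tuples (map row_set Ps)" and y: "y \<in> Y"
      by (auto simp: dist_comp_def Y_def)
    have xy: "x ! i \<in> row_set (Ps ! i)" "y ! i \<in> col_set (Ps ! i)" if "i < n" for i
      using that x y by (auto simp: tuples_def Y_def n_def)
    have xyV: "x ! i \<in> V" "y ! i \<in> V" if "i < n" for i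
      using xy[OF that] that unfolding V_def n_def by (auto intro!: bexI[of _ "Ps ! i"])
    define I where "I = diffs n x y"
    \<comment> \<open>Up to distance \<open>r\<close> all differing coordinates are controlled;
      beyond it, \<open>r + 1\<close> of them suffice, which keeps the error bound independent of
      the distance.\<close>
    obtain I' where I': "I' \<subseteq> I" "I' = I \<and> card I' \<le> r \<or> card I' = Suc r"
    proof (cases "card I \<le> r")
      case False
      then obtain I' where "I' \<subseteq> I" "card I' = Suc r"
        using obtain_subset_with_card_n[of "Suc r" I] by (metis not_less_eq_eq)
      then show ?thesis by (intro that) auto
    qed (use that in auto)
    have finI': "finite I'" using finite_subset[OF I'(1)] by (simp add: I_def)
    have sub: "I' \<subseteq> {..<n}" using I'(1) by (auto simp: I_def diffs_def)
    define eb where "eb = Suc r * (Suc r / N) + Suc r * (real (2 * r + 1) / N)"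
    let ?X = "{\<omega>. \<not> ?G \<omega> x y}"
    have "measure_pmf.prob p ?X \<le> Suc r * (1 / N) + (eb + (card Ls / 2 ^ s + (r * (\<delta> / (10 * r)) + 0)))"
      unfolding p_def
    proof (rule prob_bind_le)
      have "measure_pmf.prob ph {h. \<exists>i\<in>I'. h (i, x ! i) = h (i, y ! i)} \<le> card I' * (1 / N)"
      proof (rule prob_ex_le[OF finI'])
        fix i assume "i \<in> I'"
        then have "i < n" "x ! i \<noteq> y ! i" using I'(1) by (auto simp: I_def diffs_def)
        then show "measure_pmf.prob ph {h. h (i, x ! i) = h (i, y ! i)} \<le> 1 / N"
          unfolding ph_def by (intro prob_unif_collision) (use finV N xyV in auto)
      qed
      also have "\<dots> \<le> Suc r * (1 / N)" by (rule mult_right_mono) (use I'(2) in auto)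
      finally show "measure_pmf.prob ph {h. \<exists>i\<in>I'. h (i, x ! i) = h (i, y ! i)} \<le> Suc r * (1 / N)" .
    next
      fix h assume "h \<in> set_pmf ph" and sep: "\<not> (\<exists>i\<in>I'. h (i, x ! i) = h (i, y ! i))"
      show "measure_pmf.prob (bind_pmf pb (\<lambda>b. bind_pmf (pF h b) (\<lambda>F.
        bind_pmf pT (\<lambda>T. return_pmf (h, b, F, T))))) ?X \<le> eb + (card Ls / 2 ^ s + (r * (\<delta> / (10 * r)) + 0))"
      proof (rule prob_bind_le)
        show "measure_pmf.prob pb {b. \<not> (if card I \<le> r then inj_on b I
           else r < card (active (\<lambda>z. sketch n b h x z - sketch n b h y z)))} \<le> eb"
          unfolding pb_def eb_def I_def
          by (rule prob_bad_buckets[OF N, of I']) (use I' sep in \<open>auto simp: I_def\<close>)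
      next
        fix b assume b: "\<not> \<not> (if card I \<le> r then inj_on b I
           else r < card (active (\<lambda>z. sketch n b h x z - sketch n b h y z)))"
        show "measure_pmf.prob (bind_pmf (pF h b) (\<lambda>F.
          bind_pmf pT (\<lambda>T. return_pmf (h, b, F, T)))) ?X \<le> card Ls / 2 ^ s + (r * (\<delta> / (10 * r)) + 0)"
        proof (rule prob_bind_le)
          show "measure_pmf.prob (pF h b) {F. \<not> (\<forall>L\<in>Ls. F (\<lambda>z. sketch n b h y z + edge_sum L z) =
              F (sketch n b h x) \<longrightarrow> (\<lambda>z. sketch n b h y z + edge_sum L z) = sketch n b h x)}
            \<le> card Ls / 2 ^ s"
            using prob_fingerprint_collision[of Ls "U h b" "2 ^ s"
                "\<lambda>L z. sketch n b h y z + edge_sum L z" "sketch n b h x"] finU y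
            unfolding pF_def by (auto simp: Ls_def finite_edge_lists U_def image_iff)
        next
          fix F :: "(nat \<times> nat \<Rightarrow> int) \<Rightarrow> nat"
          assume F: "\<not> \<not> (\<forall>L\<in>Ls. F (\<lambda>z. sketch n b h y z + edge_sum L z) =
              F (sketch n b h x) \<longrightarrow> (\<lambda>z. sketch n b h y z + edge_sum L z) = sketch n b h x)"
          show "measure_pmf.prob (bind_pmf pT (\<lambda>T. return_pmf (h, b, F, T))) ?X \<le> r * (\<delta> / (10 * r)) + 0"
          proof (rule prob_bind_le)
            show "measure_pmf.prob pT {T. card I \<le> r \<and>
                (\<exists>i\<in>I. run (T i) (x ! i) (y ! i) \<noteq> entry (Ps ! i) (x ! i) (y ! i))} \<le> r * (\<delta> / (10 * r))"
            proof (cases "card I \<le> r")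
              case True
              have "measure_pmf.prob pT {T. \<exists>i\<in>I. run (T i) (x ! i) (y ! i) \<noteq> entry (Ps ! i) (x ! i) (y ! i)}
                \<le> card I * (\<delta> / (10 * r))"
              proof (rule prob_ex_le)
                fix i assume "i \<in> I"
                then have i: "i < n" by (simp add: I_def diffs_def)
                show "measure_pmf.prob pT {T. run (T i) (x ! i) (y ! i) \<noteq> entry (Ps ! i) (x ! i) (y ! i)}
                  \<le> \<delta> / (10 * r)"
                  unfolding pT_def
                  by (rule prob_resample[of _ i]) (use i D(1) xy in \<open>auto simp: computes_with_error_def\<close>)
              qed (simp add: I_def)
              also have "\<dots> \<le> r * (\<delta> / (10 * r))"
                by (rule mult_right_mono) (use True \<delta> in auto)
              finally show ?thesis using True by simp
            qed (use \<delta> in simp)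
          next
            fix T assume T: "\<not> (card I \<le> r \<and>
                (\<exists>i\<in>I. run (T i) (x ! i) (y ! i) \<noteq> entry (Ps ! i) (x ! i) (y ! i)))"
            have "\<forall>i\<in>I. h (i, x ! i) \<noteq> h (i, y ! i)" if "card I \<le> r"
              using that I' sep card_mono[of I I'] by (auto simp: I_def)
            then have "good r Ps N h b F T x y"
              using b F T unfolding good_def Let_def n_def[symmetric] I_def[symmetric] Ls_def[symmetric]
              by auto
            then show "measure_pmf.prob (return_pmf (h, b, F, T)) ?X \<le> 0" by simp
          qed simp
        qed (use \<delta> in simp)
      qed (use \<delta> in simp)
    qed (use \<delta> in \<open>simp add: eb_def\<close>)
    also have "\<dots> \<le> \<delta>"
    proof -
      have rp: "real r \<ge> 1" using r by simp
      have N': "60 * real r ^ 2 \<le> \<delta> * N"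
        using a \<delta> by (simp add: N_def field_simps)
      have cL: "card Ls / 2 ^ s = 1 / N"
      proof -
        have "card Ls = 2 ^ (3 * a * r)"
          by (simp add: Ls_def card_edge_lists N_def power_mult[symmetric] power_add[symmetric] algebra_simps)
        then show ?thesis by (simp add: s_def N_def power_add algebra_simps)
      qed
      \<comment> \<open>Hash values, buckets and fingerprint add up to
        \<open>(3 * (r + 1) ^ 2 + 1) / N\<close>, at most \<open>13 * r ^ 2 / N\<close>, which the
        choice of \<open>N\<close> turns into \<open>13 * \<delta> / 60\<close>.\<close>
      have "Suc r * (1 / N) + (eb + (card Ls / 2 ^ s + (r * (\<delta> / (10 * r)) + 0)))
        = (3 * (real r + 1) ^ 2 + 1) / N + \<delta> / 10"
        unfolding cL using N rp by (simp add: eb_def field_simps power2_eq_square)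
      also have "\<dots> \<le> 13 * \<delta> / 60 + \<delta> / 10"
      proof (rule add_right_mono)
        have "(real r + 1) ^ 2 \<le> (2 * real r) ^ 2" using rp by (intro power_mono) auto
        moreover have "1 \<le> real r ^ 2" using rp by (simp add: one_le_power)
        ultimately have "3 * (real r + 1) ^ 2 + 1 \<le> 13 * real r ^ 2" by (simp add: power_mult_distrib)
        also have "\<dots> \<le> 13 * \<delta> / 60 * N" using N' by simp
        finally show "(3 * (real r + 1) ^ 2 + 1) / N \<le> 13 * \<delta> / 60"
          using N by (simp add: divide_le_eq)
      qed
      also have "13 * \<delta> / 60 + \<delta> / 10 \<le> \<delta>" using \<delta> by simp
      finally show ?thesis .
    qed
    finally show "measure_pmf.prob p {\<omega>. \<not> ?G \<omega> x y} \<le> \<delta>" .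
  qed
qed

section \<open>Asymptotic form of the bounds\<close>

text \<open>For \<open>r = 1\<close> the claimed bound tends to a multiple of the cost of the \<open>P\<^sub>i\<close>, possibly \<open>0\<close>, as
  \<open>\<delta>\<close> tends to 1. A uniformly random answer without communication covers those \<open>\<delta>\<close>; for all others
  \<open>log 2 (r / \<delta>)\<close> is bounded below in terms of the size of the alphabet, so it absorbs constants.\<close>

lemma log2_one_plus_inverse_pos:
  fixes K :: real
  assumes "K > 0"
  shows "0 < log 2 (1 + 1 / K)"
proof -
  have "1 < 1 + 1 / K" using assms by simp
  then show ?thesis by (subst zero_less_log_cancel_iff) linarith+
qed

lemma log2_ratio_ge:
  fixes \<delta> :: real
  assumes "r \<ge> 1" "0 < \<delta>" "\<delta> < K / (K + 1)" "K > 0"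
  shows "log 2 (1 + 1 / K) \<le> log 2 (real r / \<delta>)"
proof (rule log_mono)
  have "1 + 1 / K \<le> 1 / \<delta>" using assms(2-4) by (simp add: field_simps)
  also have "\<dots> \<le> real r / \<delta>" using assms(1,2) by (simp add: divide_right_mono)
  finally show "1 + 1 / K \<le> real r / \<delta>" .
qed (use assms(4) in \<open>auto intro: add_pos_pos\<close>)

lemma pow2_ceiling_log:
  fixes z :: real
  assumes "z > 1"
  obtains a :: nat where "z \<le> 2 ^ a" "real a \<le> log 2 z + 1"
proof -
  define a where "a = nat \<lceil>log 2 z\<rceil>"
  have l: "log 2 z > 0" using assms by simp
  have "log 2 z \<le> real a" unfolding a_def by (rule real_nat_ceiling_ge)
  then have "z \<le> 2 powr real a" using assms by (simp add: log_le_iff)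
  then have "z \<le> 2 ^ a" by (simp add: powr_realpow)
  moreover have "real a \<le> log 2 z + 1" using l unfolding a_def by linarith
  ultimately show thesis by (rule that)
qed

lemma rand_cost_dist_comp_bound:
  "\<exists>C>0. \<forall>(Ps :: ('a, 'a, 'l::finite) comm_matrix list) r g \<delta> m.
     (\<forall>P\<in>set Ps. finite_matrix P) \<longrightarrow> perm_invariant r g \<longrightarrow> r \<ge> 1 \<longrightarrow>
     0 < \<delta> \<longrightarrow> \<delta> < real CARD('l) / (real CARD('l) + 1) \<longrightarrow>
     (\<forall>P\<in>set Ps. rand_cost (\<delta> / (10 * real r)) P \<le> enat m) \<longrightarrow>
     (\<exists>c. rand_cost \<delta> (dist_comp r g Ps) \<le> enat c \<and>
       real c \<le> C * (real r * log 2 (real r / \<delta>) + real r * real m))"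
proof -
  define K where "K = real CARD('l)"
  define \<tau> where "\<tau> = log 2 (1 + 1 / K)"
  \<comment> \<open>The factor \<open>7 / \<tau> + 2\<close> bounds \<open>a\<close> in terms of
    \<open>log 2 (r / \<delta>)\<close>; the leading 7 comes from
    \<open>6 * r + 1 \<le> 7 * r\<close>, and additive constants are absorbed at the price of
    \<open>1 / \<tau>\<close>.\<close>
  define C where "C = 7 * (7 / \<tau> + 2) + (1 + 2 * K) / \<tau> + 2"
  have K: "K > 0" by (simp add: K_def)
  have \<tau>: "\<tau> > 0" unfolding \<tau>_def by (rule log2_one_plus_inverse_pos[OF K])
  have "C > 0" using K \<tau> by (simp add: C_def add_pos_pos)
  moreover have "\<exists>c. rand_cost \<delta> (dist_comp r g Ps) \<le> enat c \<and>
       real c \<le> C * (real r * log 2 (real r / \<delta>) + real r * real m)"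
    if fin: "\<forall>P\<in>set Ps. finite_matrix P" and g: "perm_invariant r g" and r: "r \<ge> 1"
      and \<delta>: "0 < \<delta>" "\<delta> < K / (K + 1)"
      and m: "\<forall>P\<in>set Ps. rand_cost (\<delta> / (10 * real r)) P \<le> enat m"
    for Ps :: "('a, 'a, 'l) comm_matrix list" and r g \<delta> m
  proof -
    define X where "X = log 2 (real r / \<delta>)"
    have X: "\<tau> \<le> X" using log2_ratio_ge[OF r \<delta> K] by (simp add: X_def \<tau>_def)
    then have X1: "1 \<le> X / \<tau>" using \<tau> by simp
    have "K / (K + 1) < 1" using K by simp
    then have d1: "\<delta> < 1" using \<delta>(2) by linarith
    have r1: "real r \<ge> 1" using r by simp
    have "\<delta> < 60 * real r ^ 2" using d1 one_le_power[OF r1, of 2] by linarith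
    then have "1 < 60 * real r ^ 2 / \<delta>" using \<delta>(1) by (simp add: less_divide_eq)
    then obtain a :: nat where a: "60 * real r ^ 2 / \<delta> \<le> 2 ^ a" "real a \<le> log 2 (60 * real r ^ 2 / \<delta>) + 1"
      by (rule pow2_ceiling_log)
    \<comment> \<open>Uses \<open>60 \<le> 2 ^ 6\<close>, and
      \<open>\<delta> ^ 2 \<le> \<delta>\<close> because \<open>\<delta> < 1\<close>.\<close>
    have "60 * real r ^ 2 / \<delta> \<le> 2 ^ 6 * (real r / \<delta>) ^ 2"
      using d1 \<delta>(1) r1 by (simp add: power2_eq_square field_simps)
    then have "log 2 (60 * real r ^ 2 / \<delta>) \<le> log 2 (2 ^ 6 * (real r / \<delta>) ^ 2)"
      using \<delta>(1) r1 by (intro log_mono) auto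
    also have "\<dots> = 6 + 2 * X"
    proof -
      have "log 2 ((real r / \<delta>) ^ 2) = 2 * X" using \<delta>(1) r1 by (simp add: log_nat_power X_def)
      moreover have "log 2 (2 ^ 6) = (6::real)" by (simp only: log_pow_cancel)
      ultimately show ?thesis using \<delta>(1) r1 by (simp only: log_mult) simp
    qed
    finally have "real a \<le> 7 * 1 + 2 * X" using a(2) by simp
    also have "\<dots> \<le> 7 * (X / \<tau>) + 2 * X" using X1 by simp
    finally have aX: "real a \<le> (7 / \<tau> + 2) * X" by (simp add: algebra_simps)
    define c where "c = a * (3 * r + 1) + (Suc (3 * a * r) + r * (2 * m + 2 * CARD('l)))"
    have "real c = real a * (6 * real r + 1) + 1 + real r * (2 * real m + 2 * K)"
      by (simp add: c_def K_def algebra_simps)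
    also have "\<dots> \<le> real a * (7 * real r) + real r + real r * (2 * real m + 2 * K)"
      using r1 by (intro add_mono mult_left_mono) auto
    also have "\<dots> = real r * (7 * real a + (1 + 2 * K) * 1) + 2 * (real r * real m)"
      by (simp add: algebra_simps)
    also have "\<dots> \<le> real r * (7 * ((7 / \<tau> + 2) * X) + (1 + 2 * K) * (X / \<tau>)) + 2 * (real r * real m)"
      using aX X1 K by (intro add_mono mult_left_mono) auto
    also have "\<dots> = (7 * (7 / \<tau> + 2) + (1 + 2 * K) / \<tau>) * (real r * X) + 2 * (real r * real m)"
      by (simp add: algebra_simps add_divide_distrib)
    also have "\<dots> \<le> C * (real r * X) + C * (real r * real m)"
    proof -
      have "7 * (7 / \<tau> + 2) + (1 + 2 * K) / \<tau> \<le> C" "2 \<le> C"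
        using \<tau> K by (simp_all add: C_def)
      then show ?thesis using X \<tau> by (intro add_mono mult_right_mono) auto
    qed
    finally have "real c \<le> C * (real r * X + real r * real m)" by (simp add: algebra_simps)
    moreover have "rand_cost \<delta> (dist_comp r g Ps) \<le> enat c"
      unfolding c_def by (rule rand_cost_dist_comp) (use fin g r \<delta> m a in auto)
    ultimately show ?thesis unfolding X_def by blast
  qed
  ultimately show ?thesis unfolding K_def by blast
qed

text \<open>The output type has one value more than the alphabet, so for \<open>K\<close> letters
  random guessing fails with probability \<open>K / (K + 1)\<close>.\<close>

lemma rand_cost_dist_comp_trivial:
  fixes Ps :: "('a, 'a, 'l::finite) comm_matrix list"
  assumes "real CARD('l) / (real CARD('l) + 1) \<le> \<delta>"
  shows "rand_cost \<delta> (dist_comp r g Ps) = 0"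
proof (rule rand_cost_guess)
  show "1 - 1 / real CARD('l option) \<le> \<delta>"
    using assms by (simp add: card_UNIV_option field_simps)
qed

lemma rand_cost_antimono:
  assumes "\<delta> \<le> \<delta>'"
  shows "rand_cost \<delta>' P \<le> rand_cost \<delta> P"
  unfolding rand_cost_def computes_with_error_def
  by (rule INF_superset_mono) (use assms order_trans in blast)+

text \<open>Since \<open>(3 / 4) ^ 3 < 1 / 2\<close>, amplification with parameter
  \<open>3 * q\<close> brings the error to at most \<open>1 / 2 ^ q\<close>, and \<open>q\<close> is
  about \<open>log 2 (10 * r / \<delta>)\<close>. In the bound for \<open>q\<close>, 4 comes from
  \<open>10 \<le> 2 ^ 4\<close> and 1 from rounding up.\<close>

lemma rand_cost_small_error:
  assumes "\<delta> > 0" "\<delta> < 1" "r \<ge> 1"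
  obtains q :: nat where "real q \<le> 5 + log 2 (real r / \<delta>)"
    "\<And>(P :: ('b, 'c, 'd) comm_matrix) c.
       rand_cost (1 / 4) P \<le> enat c \<Longrightarrow> rand_cost (\<delta> / (10 * real r)) P \<le> enat (6 * q * c)"
proof -
  have r1: "1 \<le> real r" using assms(3) by simp
  then have "1 < 10 * real r / \<delta>" using assms(1,2) by (simp add: less_divide_eq)
  then obtain q :: nat where q: "10 * real r / \<delta> \<le> 2 ^ q" "real q \<le> log 2 (10 * real r / \<delta>) + 1"
    by (rule pow2_ceiling_log)
  have "log 2 (10 * real r / \<delta>) \<le> log 2 (2 ^ 4 * (real r / \<delta>))"
    using assms(1) r1 by (intro log_mono) (auto simp: divide_right_mono)
  also have "\<dots> = 4 + log 2 (real r / \<delta>)"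
    using assms(1) r1 by (simp only: log_mult log_nat_power) simp
  finally have "real q \<le> 5 + log 2 (real r / \<delta>)" using q(2) by simp
  moreover have "rand_cost (\<delta> / (10 * real r)) P \<le> enat (6 * q * c)"
    if "rand_cost (1 / 4) P \<le> enat c" for P :: "('b, 'c, 'd) comm_matrix" and c
  proof -
    have "(3 / 4 :: real) ^ (3 * q) = (27 / 64) ^ q"
      unfolding power_mult by (simp add: power3_eq_cube)
    also have "\<dots> \<le> (1 / 2) ^ q" by (rule power_mono) auto
    also have "\<dots> = 1 / 2 ^ q" by (rule power_one_over)
    also have "\<dots> \<le> 1 / (10 * real r / \<delta>)"
      using q(1) assms(1) r1 by (intro divide_left_mono) auto
    finally have "rand_cost (\<delta> / (10 * real r)) P \<le> rand_cost ((3 / 4) ^ (3 * q)) P"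
      by (intro rand_cost_antimono) simp
    also have "\<dots> \<le> enat (2 * (3 * q) * c)" by (rule rand_cost_amplify[OF that])
    finally show ?thesis by simp
  qed
  ultimately show thesis by (rule that)
qed

theorem theorem7p3:
  shows
    "(\<exists>C>0. \<forall>(\<P> :: ('a, 'a, 'l::finite) comm_matrix set) (r::nat) (g :: 'l list \<Rightarrow> 'l) Ps (\<delta>::real).
        symmetric_problem \<P> \<longrightarrow> r \<ge> 1 \<longrightarrow> perm_invariant r g \<longrightarrow> set Ps \<subseteq> \<P> \<longrightarrow>
        0 < \<delta> \<longrightarrow> \<delta> < 1 \<longrightarrow>
        ereal_of_enat (rand_cost \<delta> (dist_comp r g Ps)) \<le>
          ereal C *
          (ereal (real r * log 2 (real r / \<delta>)) +
           ereal (real r) *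
             (ereal_of_enat (SUP P\<in>set Ps. rand_cost (\<delta> / (10 * real r)) P)
              + ereal (log 2 (1 / \<delta>)))))
   \<and> (\<forall>\<P> :: ('a, 'a, 'l) comm_matrix set.
        symmetric_problem \<P> \<longrightarrow> constant_cost \<P> \<longrightarrow>
        (\<exists>C>0. \<forall>(r::nat) (g :: 'l list \<Rightarrow> 'l) (\<delta>::real).
           r \<ge> 1 \<longrightarrow> perm_invariant r g \<longrightarrow> 0 < \<delta> \<longrightarrow> \<delta> < 1 \<longrightarrow>
           ereal_of_enat (rand_cost_problem \<delta> (dist_comp_problem r g \<P>)) \<le>
             ereal (C * (real r * log 2 (real r / \<delta>)))))"
proof (intro conjI allI impI)
  define K where "K = real CARD('l)"
  have K: "K > 0" by (simp add: K_def)
  obtain C where C: "C > 0" and bound: "\<And>(Ps :: ('a, 'a, 'l) comm_matrix list) r g \<delta> m.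
     \<forall>P\<in>set Ps. finite_matrix P \<Longrightarrow> perm_invariant r g \<Longrightarrow> r \<ge> 1 \<Longrightarrow>
     0 < \<delta> \<Longrightarrow> \<delta> < K / (K + 1) \<Longrightarrow>
     \<forall>P\<in>set Ps. rand_cost (\<delta> / (10 * real r)) P \<le> enat m \<Longrightarrow>
     \<exists>c. rand_cost \<delta> (dist_comp r g Ps) \<le> enat c \<and>
       real c \<le> C * (real r * log 2 (real r / \<delta>) + real r * real m)"
    using rand_cost_dist_comp_bound[where 'a = 'a and 'l = 'l] unfolding K_def by blast
  show "\<exists>C>0. \<forall>(\<P> :: ('a, 'a, 'l) comm_matrix set) (r::nat) (g :: 'l list \<Rightarrow> 'l) Ps (\<delta>::real).
        symmetric_problem \<P> \<longrightarrow> r \<ge> 1 \<longrightarrow> perm_invariant r g \<longrightarrow> set Ps \<subseteq> \<P> \<longrightarrow>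
        0 < \<delta> \<longrightarrow> \<delta> < 1 \<longrightarrow>
        ereal_of_enat (rand_cost \<delta> (dist_comp r g Ps)) \<le>
          ereal C *
          (ereal (real r * log 2 (real r / \<delta>)) +
           ereal (real r) *
             (ereal_of_enat (SUP P\<in>set Ps. rand_cost (\<delta> / (10 * real r)) P)
              + ereal (log 2 (1 / \<delta>))))"
  proof (intro exI conjI allI impI)
    fix \<P> :: "('a, 'a, 'l) comm_matrix set" and r and g :: "'l list \<Rightarrow> 'l" and Ps and \<delta> :: real
    assume \<P>: "symmetric_problem \<P>" "set Ps \<subseteq> \<P>" and r: "r \<ge> 1" and g: "perm_invariant r g"
      and \<delta>: "0 < \<delta>" "\<delta> < 1"
    define X where "X = real r * log 2 (real r / \<delta>)"
    define M where "M = (SUP P\<in>set Ps. rand_cost (\<delta> / (10 * real r)) P)"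
    have l: "0 \<le> log 2 (1 / \<delta>)" using \<delta> by (intro zero_le_log_cancel_iff[THEN iffD2]) auto
    have "1 \<le> real r / \<delta>" using r \<delta> by (simp add: le_divide_eq)
    then have X: "0 \<le> X" unfolding X_def by (intro mult_nonneg_nonneg zero_le_log_cancel_iff[THEN iffD2]) auto
    have "ereal_of_enat (rand_cost \<delta> (dist_comp r g Ps)) \<le>
      ereal C * (ereal X + ereal (real r) * (ereal_of_enat M + ereal (log 2 (1 / \<delta>))))"
    proof (cases "\<delta> < K / (K + 1)")
      case False
      then have "rand_cost \<delta> (dist_comp r g Ps) = 0"
        unfolding K_def by (intro rand_cost_dist_comp_trivial) simp
      then show ?thesis using C X l
        by (auto intro!: ereal_0_le_mult add_nonneg_nonneg)
    next
      case True
      show ?thesis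
      proof (cases M)
        case (enat m)
        then have "\<forall>P\<in>set Ps. rand_cost (\<delta> / (10 * real r)) P \<le> enat m"
          unfolding M_def by (metis SUP_upper)
        moreover have "\<forall>P\<in>set Ps. finite_matrix P" using \<P> by (auto simp: symmetric_problem_def)
        ultimately obtain c where c: "rand_cost \<delta> (dist_comp r g Ps) \<le> enat c"
          "real c \<le> C * (X + real r * real m)"
          using bound[OF _ g r \<delta>(1) True] unfolding X_def by blast
        have "ereal_of_enat (rand_cost \<delta> (dist_comp r g Ps)) \<le> ereal (real c)"
          using c(1) by (metis ereal_of_enat_le_iff ereal_of_enat_simps(1))
        also have "real c \<le> C * (X + real r * (real m + log 2 (1 / \<delta>)))"
          using c(2) C l by (elim order_trans) (intro mult_left_mono add_mono, auto)
        finally show ?thesis using enat by simp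
      next
        \<comment> \<open>An infinite component cost makes the right-hand side infinite, as
          \<open>C\<close> and \<open>r\<close> are positive.\<close>
        case infinity
        then show ?thesis using C r by simp
      qed
    qed
    then show "ereal_of_enat (rand_cost \<delta> (dist_comp r g Ps)) \<le>
          ereal C *
          (ereal (real r * log 2 (real r / \<delta>)) +
           ereal (real r) *
             (ereal_of_enat (SUP P\<in>set Ps. rand_cost (\<delta> / (10 * real r)) P)
              + ereal (log 2 (1 / \<delta>))))"
      by (simp only: X_def M_def)
  qed (rule C)
  fix \<P> :: "('a, 'a, 'l) comm_matrix set"
  assume \<P>: "symmetric_problem \<P>" "constant_cost \<P>"
  then obtain c0 where c0: "\<And>P. P \<in> \<P> \<Longrightarrow> rand_cost (1 / 4) P \<le> enat c0"
    by (auto simp: constant_cost_def)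
  define \<tau> where "\<tau> = log 2 (1 + 1 / K)"
  \<comment> \<open>The components at error \<open>\<delta> / (10 * r)\<close> cost at most
    \<open>6 * q * c0\<close>, where \<open>q\<close> is at most \<open>5 / \<tau> + 1\<close> times
    \<open>log 2 (r / \<delta>)\<close>.\<close>
  define C' where "C' = C * (1 + 6 * real c0 * (5 / \<tau> + 1))"
  have \<tau>: "\<tau> > 0" unfolding \<tau>_def by (rule log2_one_plus_inverse_pos[OF K])
  show "\<exists>C>0. \<forall>(r::nat) (g :: 'l list \<Rightarrow> 'l) (\<delta>::real).
           r \<ge> 1 \<longrightarrow> perm_invariant r g \<longrightarrow> 0 < \<delta> \<longrightarrow> \<delta> < 1 \<longrightarrow>
           ereal_of_enat (rand_cost_problem \<delta> (dist_comp_problem r g \<P>)) \<le>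
             ereal (C * (real r * log 2 (real r / \<delta>)))"
  proof (intro exI conjI allI impI)
    show "C' > 0" unfolding C'_def using C \<tau>
      by (intro mult_pos_pos add_pos_nonneg mult_nonneg_nonneg) auto
    fix r :: nat and g :: "'l list \<Rightarrow> 'l" and \<delta> :: real
    assume r: "r \<ge> 1" and g: "perm_invariant r g" and \<delta>: "0 < \<delta>" "\<delta> < 1"
    define X where "X = log 2 (real r / \<delta>)"
    define B where "B = C' * (real r * X)"
    have "1 \<le> real r / \<delta>" using r \<delta> by (simp add: le_divide_eq)
    then have "0 \<le> X" unfolding X_def by (intro zero_le_log_cancel_iff[THEN iffD2]) auto
    then have B: "0 \<le> B" using \<open>C' > 0\<close> by (simp add: B_def)
    \<comment> \<open>Costs are natural numbers, so the real bound \<open>B\<close> may be rounded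
      down; this gives a single \<open>enat\<close> bound for the supremum over all
      compositions.\<close>
    have "rand_cost \<delta> (dist_comp r g Ps) \<le> enat (nat \<lfloor>B\<rfloor>)" if Ps: "set Ps \<subseteq> \<P>" for Ps
    proof (cases "\<delta> < K / (K + 1)")
      case False
      then show ?thesis
        using rand_cost_dist_comp_trivial[of \<delta> r g Ps] by (simp add: K_def)
    next
      case True
      have "\<tau> \<le> X" using log2_ratio_ge[OF r \<delta>(1) True K] by (simp add: X_def \<tau>_def)
      then have X1: "1 \<le> X / \<tau>" using \<tau> by simp
      obtain q where q: "real q \<le> 5 + X"
        "\<And>(P :: ('a, 'a, 'l) comm_matrix) c.
          rand_cost (1 / 4) P \<le> enat c \<Longrightarrow> rand_cost (\<delta> / (10 * real r)) P \<le> enat (6 * q * c)"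
        unfolding X_def using rand_cost_small_error[OF \<delta> r] by metis
      have "\<forall>P\<in>set Ps. rand_cost (\<delta> / (10 * real r)) P \<le> enat (6 * q * c0)"
        using Ps c0 q(2) by blast
      moreover have "\<forall>P\<in>set Ps. finite_matrix P" using \<P> Ps by (auto simp: symmetric_problem_def)
      ultimately obtain c where c: "rand_cost \<delta> (dist_comp r g Ps) \<le> enat c"
        "real c \<le> C * (real r * X + real r * real (6 * q * c0))"
        using bound[OF _ g r \<delta>(1) True] unfolding X_def by blast
      have "real q \<le> 5 * (X / \<tau>) + X" using q(1) X1 by simp
      then have "real q \<le> (5 / \<tau> + 1) * X" by (simp add: algebra_simps)
      then have "6 * real c0 * real q \<le> 6 * real c0 * ((5 / \<tau> + 1) * X)"
        by (rule mult_left_mono) simp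
      then have "real (6 * q * c0) \<le> 6 * real c0 * ((5 / \<tau> + 1) * X)"
        by (simp only: of_nat_mult of_nat_numeral mult_ac)
      then have "C * (real r * X + real r * real (6 * q * c0)) \<le>
        C * (real r * X + real r * (6 * real c0 * ((5 / \<tau> + 1) * X)))"
        using C by (intro mult_left_mono add_mono) auto
      also have "\<dots> = B" by (simp add: B_def C'_def algebra_simps)
      finally have "real c \<le> B" using c(2) by simp
      then have "c \<le> nat \<lfloor>B\<rfloor>" by (rule le_nat_floor)
      then show ?thesis using c(1) by (meson enat_ord_simps(1) order_trans)
    qed
    then have "rand_cost_problem \<delta> (dist_comp_problem r g \<P>) \<le> enat (nat \<lfloor>B\<rfloor>)"
      unfolding rand_cost_problem_def dist_comp_problem_def by (auto intro: SUP_least)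
    then have "ereal_of_enat (rand_cost_problem \<delta> (dist_comp_problem r g \<P>)) \<le> ereal (real (nat \<lfloor>B\<rfloor>))"
      by (metis ereal_of_enat_le_iff ereal_of_enat_simps(1))
    also have "\<dots> \<le> ereal B" using B by simp
    finally show "ereal_of_enat (rand_cost_problem \<delta> (dist_comp_problem r g \<P>)) \<le>
      ereal (C' * (real r * log 2 (real r / \<delta>)))" by (simp add: B_def X_def)
  qed
qed

end
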